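(* Let $0<\alpha<1$ and $\lambda>0$. Let $\{N_\alpha(t_1,t_2),\ (t_1,t_2)\in\mathbb{R}^2_+\}$ be the space fractional Poisson random field with parameter $\lambda$. Let $\{N(t),\ t\ge0\}$ be a Poisson process with transition rate $\lambda$ which is independent of a two parameter stable subordinator $\{H_\alpha(t_1,t_2),\ (t_1,t_2)\in\mathbb{R}^2_+\}$ of index $\alpha$. Then, for each $(t_1,t_2)\in\mathbb{R}^2_+$, $$N_\alpha(t_1,t_2)\overset{d}{=} N(H_\alpha(t_1,t_2)),$$ where $\overset{d}{=}$ denotes equality in distribution.
   Context: $\mathbb{R}_+=[0,\infty)$. Space fractional Poisson random field (SFPRF), $0<\alpha\le1$: a nonnegative-integer-valued random field $\{N_\alpha(t_1,t_2)\}$ on $\mathbb{R}^2_+$, depending on a parameter $\lambda>0$, whose state probabilities $p_\alpha(n,t_1,t_2)=\mathrm{Pr}\{N_\alpha(t_1,t_2)=n\}$ (regarded also as functions of $\lambda\in(0,\infty)$) solve $$\frac{\partial^2}{\partial t_2\partial t_1}p_\alpha(n,t_1,t_2)=-\bigg(\frac{\lambda^{\alpha+1}}{\alpha}\frac{\partial}{\partial\lambda}+\lambda^\alpha\bigg)(I-B)^\alpha p_\alpha(n,t_1,t_2),\quad n\ge0,$$ with $p_\alpha(0,0,t_2)=p_\alpha(0,t_1,0)=p_\alpha(0,0,0)=1$ for all $t_1,t_2\ge0$ and $p_\alpha(n,t_1,t_2)=0$ for $n<0$. Here $B$ is the backward shift operator, $Bp(n,t_1,t_2)=p(n-1,t_1,t_2)$,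 and $(I-B)^\alpha=\sum_{k=0}^\infty\frac{(\alpha)_k}{k!}(-B)^k$ with $(\alpha)_k=\alpha(\alpha-1)\cdots(\alpha-k+1)$, $(\alpha)_0=1$. Two parameter stable subordinator of index $\alpha\in(0,1)$: a real-valued process $\{H_\alpha(t_1,t_2)\}$ on $\mathbb{R}^2_+$ that vanishes almost surely on the axes, has stationary and independent increments over disjoint rectangles $(s_1,t_1]\times(s_2,t_2]$ (the increment being $X(t_1,t_2)-X(s_1,t_2)-X(t_1,s_2)+X(s_1,s_2)$), satisfies $H_\alpha(t_1,t_2)\le H_\alpha(t_1',t_2')$ whenever $t_1\le t_1'$, $t_2\le t_2'$, and has $\mathbb{E}e^{-uH_\alpha(t_1,t_2)}=e^{-t_1t_2u^\alpha}$, $u>0$. *)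

theory Defs
  imports "HOL-Probability.Probability"
begin

section \<open>The state equations of the space fractional Poisson random field\<close>

definition backward_shift :: "(int \<Rightarrow> real) \<Rightarrow> int \<Rightarrow> real" where
  "backward_shift q n = q (n - 1)"

text \<open>
  \<open>(I - B)\<^sup>\<alpha> = \<Sum>k. (\<alpha>)\<^sub>k / k! (-B)\<^sup>k\<close>, where \<open>(\<alpha>)\<^sub>k\<close> is the falling factorial, so that
  \<open>(\<alpha>)\<^sub>k / k! = \<alpha> gchoose k\<close>.
  The series has only finitely many nonzero terms when \<open>q\<close> vanishes on negative arguments.
\<close>

definition fractional_difference :: "real \<Rightarrow> (int \<Rightarrow> real) \<Rightarrow> int \<Rightarrow> real" where
  "fractional_difference \<alpha> q n = (\<Sum>k. (\<alpha> gchoose k) * (- 1) ^ k * (backward_shift ^^ k) q n)"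

definition mixed_deriv :: "(real \<Rightarrow> real \<Rightarrow> real) \<Rightarrow> real \<Rightarrow> real \<Rightarrow> real" where
  "mixed_deriv f t1 t2 = deriv (\<lambda>s. deriv (\<lambda>r. f r s) t1) t2"

definition mixed_differentiable :: "(real \<Rightarrow> real \<Rightarrow> real) \<Rightarrow> real \<Rightarrow> real \<Rightarrow> bool" where
  "mixed_differentiable f t1 t2 \<longleftrightarrow>
     (\<lambda>r. f r t2) differentiable at t1 \<and>
     (\<lambda>s. deriv (\<lambda>r. f r s) t1) differentiable at t2"

text \<open>
  \<open>p l n t1 t2\<close> stands for \<open>p\<^sub>\<alpha>(n, t\<^sub>1, t\<^sub>2)\<close> at the parameter value \<open>l > 0\<close>. Solutions are classical:
  the derivatives in the equation exist in the open quadrant, the mixed time derivative is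
  continuous there jointly with \<open>l\<close>, and \<open>p\<close> is continuous up to the axes, so that the boundary
  values are attained.
\<close>

definition sf_state_equations :: "real \<Rightarrow> (real \<Rightarrow> int \<Rightarrow> real \<Rightarrow> real \<Rightarrow> real) \<Rightarrow> bool" where
  "sf_state_equations \<alpha> p \<longleftrightarrow>
     (\<forall>n\<ge>0. \<forall>l>0. continuous_on ({0..} \<times> {0..}) (\<lambda>(t1, t2). p l n t1 t2)) \<and>
     (\<forall>n\<ge>0. \<forall>l>0. \<forall>t1>0. \<forall>t2>0. mixed_differentiable (p l n) t1 t2) \<and>
     (\<forall>n\<ge>0. continuous_on ({0<..} \<times> {0<..} \<times> {0<..})
        (\<lambda>(l, t1, t2). mixed_deriv (p l n) t1 t2)) \<and>
     (\<forall>n\<ge>0. \<forall>l>0. \<forall>t1>0. \<forall>t2>0.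
        (\<lambda>l. fractional_difference \<alpha> (\<lambda>m. p l m t1 t2) n) differentiable at l \<and>
        mixed_deriv (p l n) t1 t2 =
          - (l powr (\<alpha> + 1) / \<alpha> * deriv (\<lambda>l. fractional_difference \<alpha> (\<lambda>m. p l m t1 t2) n) l
             + l powr \<alpha> * fractional_difference \<alpha> (\<lambda>m. p l m t1 t2) n)) \<and>
     (\<forall>l>0. \<forall>t\<ge>0. p l 0 0 t = 1 \<and> p l 0 t 0 = 1) \<and>
     (\<forall>n<0. \<forall>l>0. \<forall>t1\<ge>0. \<forall>t2\<ge>0. p l n t1 t2 = 0)"

text \<open>
  Since the equation differentiates in the parameter, the random field is given as a family
  indexed by \<open>l > 0\<close>; the underlying probability space may depend on \<open>l\<close>.
\<close>

definition space_fractional_poisson_field ::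
    "real \<Rightarrow> (real \<Rightarrow> 'a measure) \<Rightarrow> (real \<Rightarrow> real \<Rightarrow> real \<Rightarrow> 'a \<Rightarrow> nat) \<Rightarrow> bool" where
  "space_fractional_poisson_field \<alpha> M X \<longleftrightarrow>
     0 < \<alpha> \<and> \<alpha> \<le> 1 \<and>
     (\<forall>l>0. prob_space (M l) \<and>
        (\<forall>t1\<ge>0. \<forall>t2\<ge>0. X l t1 t2 \<in> M l \<rightarrow>\<^sub>M count_space UNIV)) \<and>
     sf_state_equations \<alpha>
       (\<lambda>l n t1 t2. measure (M l) {\<omega> \<in> space (M l). int (X l t1 t2 \<omega>) = n})"


section \<open>The Poisson process\<close>

text \<open>
  The almost sure path properties (nondecreasing, right-continuous) are part of the notion; without
  them the law of the process at an independent random time would not be determined by its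
  finite-dimensional distributions. Monotonicity also makes the truncated subtraction on
  \<^typ>\<open>nat\<close> harmless.
\<close>

definition poisson_process :: "'a measure \<Rightarrow> real \<Rightarrow> (real \<Rightarrow> 'a \<Rightarrow> nat) \<Rightarrow> bool" where
  "poisson_process M rate N \<longleftrightarrow>
     prob_space M \<and> 0 < rate \<and>
     (\<forall>t\<ge>0. N t \<in> M \<rightarrow>\<^sub>M count_space UNIV) \<and>
     (AE \<omega> in M. N 0 \<omega> = 0) \<and>
     (AE \<omega> in M. mono_on {0..} (\<lambda>t. N t \<omega>) \<and>
        (\<forall>t\<ge>0. continuous (at_right t) (\<lambda>s. N s \<omega>))) \<and>
     (\<forall>\<tau> k. 0 \<le> \<tau> 0 \<and> mono \<tau> \<longrightarrow>
        prob_space.indep_vars M (\<lambda>_. count_space UNIV)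
          (\<lambda>i \<omega>. N (\<tau> (Suc i)) \<omega> - N (\<tau> i) \<omega>) {..<k::nat}) \<and>
     (\<forall>s t. 0 \<le> s \<and> s < t \<longrightarrow>
        distr M (count_space UNIV) (\<lambda>\<omega>. N t \<omega> - N s \<omega>)
          = measure_pmf (poisson_pmf (rate * (t - s))))"


section \<open>The two parameter stable subordinator\<close>

text \<open>
  The pair \<open>((s1, s2), (t1, t2))\<close> encodes the rectangle \<open>(s1, t1] \<times> (s2, t2]\<close>.
\<close>

type_synonym rectangle = "(real \<times> real) \<times> (real \<times> real)"

definition rectangles :: "rectangle set" where
  "rectangles = {((s1, s2), (t1, t2)) | s1 s2 t1 t2. 0 \<le> s1 \<and> s1 < t1 \<and> 0 \<le> s2 \<and> s2 < t2}"

definition rect_set :: "rectangle \<Rightarrow> (real \<times> real) set" where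
  "rect_set = (\<lambda>((s1, s2), (t1, t2)). {s1<..t1} \<times> {s2<..t2})"

definition rect_increment :: "(real \<Rightarrow> real \<Rightarrow> 'a \<Rightarrow> real) \<Rightarrow> rectangle \<Rightarrow> 'a \<Rightarrow> real" where
  "rect_increment X = (\<lambda>((s1, s2), (t1, t2)) \<omega>.
     X t1 t2 \<omega> - X s1 t2 \<omega> - X t1 s2 \<omega> + X s1 s2 \<omega>)"

definition rect_shift :: "real \<times> real \<Rightarrow> rectangle \<Rightarrow> rectangle" where
  "rect_shift h = (\<lambda>(s, t). (s + h, t + h))"

definition stable_subordinator2 ::
    "'a measure \<Rightarrow> real \<Rightarrow> (real \<Rightarrow> real \<Rightarrow> 'a \<Rightarrow> real) \<Rightarrow> bool" where
  "stable_subordinator2 M \<alpha> H \<longleftrightarrow>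
     prob_space M \<and> 0 < \<alpha> \<and> \<alpha> < 1 \<and>
     (\<forall>t1\<ge>0. \<forall>t2\<ge>0. H t1 t2 \<in> borel_measurable M) \<and>
     (\<forall>t\<ge>0. AE \<omega> in M. H 0 t \<omega> = 0 \<and> H t 0 \<omega> = 0) \<and>
     (\<forall>R \<in> rectangles. \<forall>h1\<ge>0. \<forall>h2\<ge>0.
        distr M borel (rect_increment H (rect_shift (h1, h2) R))
          = distr M borel (rect_increment H R)) \<and>
     (\<forall>\<R> \<subseteq> rectangles. finite \<R> \<and> disjoint_family_on rect_set \<R> \<longrightarrow>
        prob_space.indep_vars M (\<lambda>_. borel) (rect_increment H) \<R>) \<and>
     (\<forall>s1 s2 t1 t2. 0 \<le> s1 \<and> s1 \<le> t1 \<and> 0 \<le> s2 \<and> s2 \<le> t2 \<longrightarrow>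
        (AE \<omega> in M. H s1 s2 \<omega> \<le> H t1 t2 \<omega>)) \<and>
     (\<forall>t1\<ge>0. \<forall>t2\<ge>0. \<forall>u>0.
        prob_space.expectation M (\<lambda>\<omega>. exp (- u * H t1 t2 \<omega>)) = exp (- (t1 * t2 * u powr \<alpha>)))"


section \<open>Independence and equality in distribution\<close>

definition process_events ::
    "'a measure \<Rightarrow> 'i set \<Rightarrow> 'b measure \<Rightarrow> ('i \<Rightarrow> 'a \<Rightarrow> 'b) \<Rightarrow> 'a set set" where
  "process_events M I S X =
     sets (vimage_algebra (space M) (\<lambda>\<omega>. \<lambda>i\<in>I. X i \<omega>) (Pi\<^sub>M I (\<lambda>_. S)))"

definition independent_processes ::
    "'a measure \<Rightarrow> 'i set \<Rightarrow> 'b measure \<Rightarrow> ('i \<Rightarrow> 'a \<Rightarrow> 'b)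
       \<Rightarrow> 'j set \<Rightarrow> 'c measure \<Rightarrow> ('j \<Rightarrow> 'a \<Rightarrow> 'c) \<Rightarrow> bool" where
  "independent_processes M I S X J T Y \<longleftrightarrow>
     prob_space.indep_set M (process_events M I S X) (process_events M J T Y)"

definition equal_in_distribution ::
    "'c measure \<Rightarrow> 'a measure \<Rightarrow> ('a \<Rightarrow> 'c) \<Rightarrow> 'b measure \<Rightarrow> ('b \<Rightarrow> 'c) \<Rightarrow> bool" where
  "equal_in_distribution S M X M' Y \<longleftrightarrow>
     X \<in> M \<rightarrow>\<^sub>M S \<and> Y \<in> M' \<rightarrow>\<^sub>M S \<and> distr M S X = distr M' S Y"

text \<open>
  The subordinator is nonnegative, and the Poisson paths are regular, only almost surely. The
  composition \<open>N(H(t\<^sub>1, t\<^sub>2))\<close> is therefore a random variable up to a null set, that is, on the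
  completion of the underlying probability space.
\<close>

definition subordinated ::
    "(real \<Rightarrow> 'a \<Rightarrow> nat) \<Rightarrow> (real \<Rightarrow> real \<Rightarrow> 'a \<Rightarrow> real) \<Rightarrow> real \<Rightarrow> real \<Rightarrow> 'a \<Rightarrow> nat" where
  "subordinated N H t1 t2 \<omega> = N (H t1 t2 \<omega>) \<omega>"

end

(*
  Conditioning on the subordinator, N(H(t1,t2)) has generating function
  exp(- w (1 - z)^a) with w = lam^a t1 t2. Its coefficients, as functions of w, satisfy
  d/dw G = - (1 - z)^a G, which makes them a solution of the state equations.

  The point is uniqueness. By induction on n, the difference d of two solutions satisfies
  d_12 = - (l^(a+1)/a d_l + l^a d) and vanishes on the axes. In the variable tau = l^(-a) the
  function q = d / tau satisfies q_12 = q_tau. Hence the k-fold iterated time integral U_k of q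
  is a k-th antiderivative of q in tau, and |U_k| <= B (t1 t2)^k / (k!)^2. By the mean value
  theorem for k-th differences this decay is only possible if q = 0. No initial condition in
  tau is available, and none is needed.
*)
theory Submission
  imports Defs
begin

unbundle no vec_syntax
unbundle fps_syntax

section \<open>Uniqueness for the characteristic boundary value problem\<close>

text \<open>The equation is of first order in \<open>l\<close> but carries no data at any value of
  \<open>l\<close>, so nothing can be propagated in the parameter. What replaces data is
  boundedness: probabilities are at most 1. Integrating q_12 = q_tau over [0, t1] x [0, t2]
  reproduces q on the left, because q vanishes on the axes; time integration therefore inverts
  d/dtau and can be iterated. Each of the two time variables contributes a factor 1/k! to U_k.
  Recovering q from U_k by k differences of step delta/k costs k^k, which is about one k!. The other
  factorial beats every geometric factor, however short delta is; with a single factorial only a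
  geometric bound would remain, useless for small delta. Regularity is scarce: differentiability in
  \<open>l\<close> is postulated for the fractional difference alone, and the mixed time derivative
  is controlled only inside the quadrant. On the probabilistic side the law is recognised by a
  first-order equation in z, so the convergence of a composed power series is never
  examined.\<close>

fun fdiff :: "real \<Rightarrow> nat \<Rightarrow> (real \<Rightarrow> real) \<Rightarrow> real \<Rightarrow> real" where
  "fdiff h 0 f x = f x"
| "fdiff h (Suc k) f x = fdiff h k f (x + h) - fdiff h k f x"

lemma fdiff_has_real_derivative:
  assumes "h \<ge> 0" and "\<And>y. c < y \<Longrightarrow> (f has_real_derivative f' y) (at y)" and "c < x"
  shows "(fdiff h k f has_real_derivative fdiff h k f' x) (at x)"
  using assms(3)
proof (induction k arbitrary: x)
  case (Suc k)
  have "((\<lambda>x. fdiff h k f (x + h)) has_real_derivative fdiff h k f' (x + h)) (at x)"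
    using Suc.IH[of "x + h"] Suc.prems \<open>h \<ge> 0\<close> by (intro iffD1[OF DERIV_shift]) simp
  then show ?case
    using Suc.IH[OF Suc.prems] by (auto simp: fun_eq_iff intro!: DERIV_diff)
next
  case 0
  have "fdiff h 0 f = f" "fdiff h 0 f' = f'" by auto
  with assms(2)[OF 0] show ?case by simp
qed

text \<open>Each differencing at most doubles a bound, and \<open>h \<ge> 0\<close> keeps all sample
  points in the half-line. The factor \<open>2 ^ k\<close> is crude but harmless against a
  factorial.\<close>

lemma abs_fdiff_le:
  assumes "h \<ge> 0" and "\<And>y. c < y \<Longrightarrow> \<bar>f y\<bar> \<le> C" and "c < x"
  shows "\<bar>fdiff h k f x\<bar> \<le> 2 ^ k * C"
  using assms(3)
proof (induction k arbitrary: x)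
  case (Suc k)
  show ?case
    using Suc.IH[of "x + h"] Suc.IH[OF Suc.prems] Suc.prems \<open>h \<ge> 0\<close> by simp
qed (use assms(2) in auto)

text \<open>One difference is removed at a time: the derivative of the \<open>k\<close>-th
  difference of \<open>F (Suc k)\<close> is the \<open>k\<close>-th difference of
  \<open>F k\<close>, so the ordinary mean value theorem applies. Each removal moves the point by
  less than \<open>h\<close>, whence the interval of length \<open>k * h\<close>.\<close>

lemma fdiff_mean_value:
  assumes "h > 0" and "\<And>k y. c < y \<Longrightarrow> (F (Suc k) has_real_derivative F k y) (at y)" and "c < x"
  shows "\<exists>\<xi>\<in>{x..x + real k * h}. fdiff h k (F k) x = h ^ k * F 0 \<xi>"
  using assms(3)
proof (induction k arbitrary: x)
  case (Suc k)
  have "\<exists>z. x < z \<and> z < x + h \<and>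
      fdiff h k (F (Suc k)) (x + h) - fdiff h k (F (Suc k)) x = (x + h - x) * fdiff h k (F k) z"
    by (rule MVT2)
       (use Suc.prems \<open>h > 0\<close> in \<open>auto intro!: fdiff_has_real_derivative[where c = c] assms(2)\<close>)
  then obtain z where z: "x < z" "z < x + h"
    "fdiff h (Suc k) (F (Suc k)) x = h * fdiff h k (F k) z"
    by auto
  obtain \<xi> where "\<xi> \<in> {z..z + real k * h}" "fdiff h k (F k) z = h ^ k * F 0 \<xi>"
    using Suc.IH[of z] z(1) Suc.prems by auto
  then show ?case
    using z by (intro bexI[of _ \<xi>]) (auto simp: algebra_simps)
qed auto

text \<open>A single term of the exponential series is below the whole sum. It serves for k^k
  against k! here, and later for bounds on Poisson weights that are uniform in
  \<open>w\<close>.\<close>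

lemma power_div_fact_le_exp:
  fixes w :: real
  assumes "0 \<le> w"
  shows "w ^ n / fact n \<le> exp w"
proof -
  have "(\<Sum>j\<in>{n}. inverse (fact j) * w ^ j) \<le> (\<Sum>j. inverse (fact j) * w ^ j)"
    by (rule sum_le_suminf[OF summable_exp]) (use assms in auto)
  then show ?thesis
    by (simp add: exp_def field_simps)
qed

text \<open>
  The \<open>k\<close>-th difference of \<open>F k\<close> with step \<open>\<delta> / k\<close> is \<open>(\<delta> / k)\<^sup>k\<close> times a value of \<open>F 0\<close> on
  \<open>[x, x + \<delta>]\<close>. Since \<open>k\<^sup>k \<le> e\<^sup>k k!\<close>, the decay \<open>1 / (k!)\<^sup>2\<close> forces these values to tend to \<open>0\<close>.
\<close>

lemma vanishing_of_small_antiderivatives: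
  assumes deriv: "\<And>k y. c < y \<Longrightarrow> (F (Suc k) has_real_derivative F k y) (at y)"
    and bound: "\<And>k y. c < y \<Longrightarrow> \<bar>F k y\<bar> \<le> B * s ^ k / (fact k)\<^sup>2"
    and "0 \<le> s" and "c < x" and cont: "isCont (F 0) x"
  shows "F 0 x = 0"
proof (rule ccontr)
  assume nz: "F 0 x \<noteq> 0"
  define e where "e = \<bar>F 0 x\<bar> / 2"
  have "e > 0" using nz by (simp add: e_def)
  obtain \<delta>0 where \<delta>0: "\<delta>0 > 0" "\<And>y. \<bar>y - x\<bar> < \<delta>0 \<Longrightarrow> \<bar>F 0 y - F 0 x\<bar> < e"
    using cont[unfolded continuous_at_eps_delta] \<open>e > 0\<close> by (auto simp: dist_real_def)
  define \<delta> where "\<delta> = \<delta>0 / 2"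
  have "\<delta> > 0" "\<delta> < \<delta>0" using \<delta>0 by (auto simp: \<delta>_def)
  have large: "e \<le> \<bar>F 0 y\<bar>" if "y \<in> {x..x + \<delta>}" for y
  proof -
    have "\<bar>F 0 y - F 0 x\<bar> < e"
      using that \<open>\<delta> < \<delta>0\<close> by (intro \<delta>0(2)) auto
    then show ?thesis unfolding e_def by arith
  qed
  have B: "B \<ge> 0" using bound[of x 0] \<open>c < x\<close> by simp
  \<comment> \<open>Collects the geometric factors: 2 from the differences, \<open>s\<close> from
    the bound on \<open>F k\<close>, \<open>exp 1\<close> from k^k, and \<open>1 / \<delta>\<close>
    from the step length. One factorial is left over in the denominator.\<close>
  define r where "r = 2 * s * exp 1 / \<delta>"
  have *: "b * u * (v * f) / f\<^sup>2 = b * (inverse f * (u * v))" if "f \<noteq> 0" for b u v f :: real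
    using that by (simp add: power2_eq_square field_simps)
  have "e \<le> B * (inverse (fact k) * r ^ k)" if k: "k > 0" for k
  proof -
    define h where "h = \<delta> / real k"
    have h: "h > 0" "real k * h = \<delta>" using \<open>\<delta> > 0\<close> k by (auto simp: h_def)
    obtain \<xi> where \<xi>: "\<xi> \<in> {x..x + real k * h}" "fdiff h k (F k) x = h ^ k * F 0 \<xi>"
      using fdiff_mean_value[where F = F and c = c and x = x and k = k, OF h(1)] deriv \<open>c < x\<close>
      by blast
    have "\<bar>fdiff h k (F k) x\<bar> \<le> 2 ^ k * (B * s ^ k / (fact k)\<^sup>2)"
      by (rule abs_fdiff_le[where c = c, OF less_imp_le[OF h(1)] bound \<open>c < x\<close>])
    then have "h ^ k * \<bar>F 0 \<xi>\<bar> \<le> 2 ^ k * (B * s ^ k / (fact k)\<^sup>2)"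
      using \<xi>(2) h by (simp add: abs_mult power_abs)
    moreover have "h ^ k * e \<le> h ^ k * \<bar>F 0 \<xi>\<bar>"
      using large[of \<xi>] \<xi>(1) h by (intro mult_left_mono) auto
    ultimately have "h ^ k * e \<le> 2 ^ k * (B * s ^ k / (fact k)\<^sup>2)"
      by linarith
    then have "e \<le> 2 ^ k * (B * s ^ k / (fact k)\<^sup>2) / h ^ k"
      using h by (simp add: pos_le_divide_eq mult.commute)
    also have "\<dots> = B * (2 * s / \<delta>) ^ k * real k ^ k / (fact k)\<^sup>2"
      by (simp add: h_def power_divide power_mult_distrib mult_ac)
    also have "\<dots> \<le> B * (2 * s / \<delta>) ^ k * (exp (real k) * fact k) / (fact k)\<^sup>2"
      using B \<open>0 \<le> s\<close> \<open>\<delta> > 0\<close> power_div_fact_le_exp[of "real k" k]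
      by (intro divide_right_mono mult_left_mono mult_nonneg_nonneg zero_le_power)
         (simp_all add: divide_le_eq)
    also have "\<dots> = B * (inverse (fact k) * ((2 * s / \<delta>) ^ k * exp (real k)))"
      by (rule *) simp
    also have "(2 * s / \<delta>) ^ k * exp (real k) = r ^ k"
      using exp_of_nat_mult[of k "1::real"] by (simp add: r_def power_mult_distrib power_divide)
    finally show ?thesis .
  qed
  moreover have "(\<lambda>k. B * (inverse (fact k) * r ^ k)) \<longlonglongrightarrow> 0"
    by (intro tendsto_mult_right_zero summable_LIMSEQ_zero summable_exp)
  ultimately have "e \<le> 0"
    by (intro LIMSEQ_le_const) (auto intro!: exI[of _ 1])
  with \<open>e > 0\<close> show False by simp
qed

text \<open>Pointwise convergence under a common bound takes the place of uniform convergence of the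
  derivatives: the fundamental theorem for \<open>F n\<close> passes to the limit by dominated
  convergence, and continuity of \<open>g'\<close> makes the limiting integral
  differentiable.\<close>

lemma derivative_of_bounded_limit:
  fixes F :: "nat \<Rightarrow> real \<Rightarrow> real"
  assumes deriv: "\<And>n y. c < y \<Longrightarrow> (F n has_real_derivative g n y) (at y)"
    and bound: "\<And>n y. c < y \<Longrightarrow> \<bar>g n y\<bar> \<le> C"
    and F: "\<And>y. c < y \<Longrightarrow> (\<lambda>n. F n y) \<longlonglongrightarrow> F' y"
    and g: "\<And>y. c < y \<Longrightarrow> (\<lambda>n. g n y) \<longlonglongrightarrow> g' y"
    and cont: "continuous_on {c<..} g'" and "c < x"
  shows "(F' has_real_derivative g' x) (at x)"
proof -
  \<comment> \<open>A base point strictly between \<open>c\<close> and \<open>x\<close> makes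
    \<open>x\<close> interior to \<open>{a..x + 1}\<close>, so the derivative within that interval
    is a full derivative.\<close>
  define a where "a = (c + x) / 2"
  have a: "c < a" "a < x" using \<open>c < x\<close> by (auto simp: a_def)
  have FTC: "(g n has_integral (F n y - F n a)) {a..y}" if "a \<le> y" for n y
    using that a
    by (intro fundamental_theorem_of_calculus)
       (auto simp: has_real_derivative_iff_has_vector_derivative[symmetric]
             intro!: DERIV_subset[OF deriv])
  have F'_eq: "F' y = F' a + integral {a..y} g'" if "a \<le> y" for y
  proof -
    have "(\<lambda>n. integral {a..y} (g n)) \<longlonglongrightarrow> integral {a..y} g'"
    proof (rule dominated_convergence(2))
      show "(\<lambda>_. C) integrable_on {a..y}" by (rule integrable_const_ivl)
      show "g k integrable_on {a..y}" for k
        using FTC[OF that] by (rule has_integral_integrable)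
      show "norm (g k z) \<le> C" if "z \<in> {a..y}" for k z
        using bound[of z k] that a by auto
      show "(\<lambda>k. g k z) \<longlonglongrightarrow> g' z" if "z \<in> {a..y}" for z
        using g[of z] that a by auto
    qed
    moreover have "integral {a..y} (g n) = F n y - F n a" for n
      using FTC[OF that] by (rule integral_unique)
    moreover have "(\<lambda>n. F n y - F n a) \<longlonglongrightarrow> F' y - F' a"
      using a that by (intro tendsto_diff F) auto
    ultimately have "integral {a..y} g' = F' y - F' a"
      using LIMSEQ_unique by (metis (no_types, lifting) ext)
    then show ?thesis by simp
  qed
  have "((\<lambda>y. integral {a..y} g') has_real_derivative g' x) (at x within {a..x + 1})"
    by (rule integral_has_real_derivative) (use a in \<open>auto intro!: continuous_on_subset[OF cont]\<close>)
  then have "((\<lambda>y. F' a + integral {a..y} g') has_real_derivative g' x) (at x within {a..x + 1})"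
    by (auto intro!: derivative_eq_intros)
  then have "(F' has_real_derivative g' x) (at x within {a..x + 1})"
    by (rule has_field_derivative_transform_within[where d = 1])
       (use a in \<open>auto simp: F'_eq[symmetric]\<close>)
  then show ?thesis
    using a by (simp add: at_within_Icc_at)
qed

text \<open>The mean value inequality bounds all difference quotients by \<open>C\<close>, so
  dominated convergence applies along every sequence. This form suits the iterated integrals below,
  for which continuity is established only at fixed parameter.\<close>

lemma integral_has_real_derivative_dominated:
  fixes f f' :: "real \<Rightarrow> 'a::euclidean_space \<Rightarrow> real"
  assumes deriv: "\<And>y z. c < y \<Longrightarrow> z \<in> cbox p q \<Longrightarrow> ((\<lambda>y. f y z) has_real_derivative f' y z) (at y)"
    and bound: "\<And>y z. c < y \<Longrightarrow> z \<in> cbox p q \<Longrightarrow> \<bar>f' y z\<bar> \<le> C"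
    and int: "\<And>y. c < y \<Longrightarrow> f y integrable_on cbox p q"
    and "c < x"
  shows "((\<lambda>y. integral (cbox p q) (f y)) has_real_derivative integral (cbox p q) (f' x)) (at x)"
  unfolding has_field_derivative_iff
proof (rule iffD2[OF tendsto_at_iff_sequentially], intro allI impI)
  fix X :: "nat \<Rightarrow> real"
  assume X: "\<forall>i. X i \<in> UNIV - {x}" "X \<longlonglongrightarrow> x"
  \<comment> \<open>Only a tail of the sequence lies in the half-line; the shift by \<open>m\<close>
    is undone at the end by \<open>LIMSEQ_offset\<close>.\<close>
  obtain m where m: "\<And>i. i \<ge> m \<Longrightarrow> c < X i"
    using order_tendstoD(1)[OF X(2) \<open>c < x\<close>] by (auto simp: eventually_sequentially)
  define Y where "Y i = X (i + m)" for i
  have Y: "Y i \<noteq> x" "c < Y i" for i using X(1) m by (auto simp: Y_def)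
  have limY: "Y \<longlonglongrightarrow> x" unfolding Y_def by (rule LIMSEQ_ignore_initial_segment[OF X(2)])
  have "(\<lambda>i. integral (cbox p q) (\<lambda>z. (f (Y i) z - f x z) / (Y i - x)))
      \<longlonglongrightarrow> integral (cbox p q) (f' x)"
  proof (rule dominated_convergence(2))
    show "(\<lambda>_. C) integrable_on cbox p q" by (rule integrable_const)
    show "(\<lambda>z. (f (Y k) z - f x z) / (Y k - x)) integrable_on cbox p q" for k
      unfolding divide_inverse
      by (intro integrable_on_mult_left integrable_diff int Y \<open>c < x\<close>)
    show "norm ((f (Y k) z - f x z) / (Y k - x)) \<le> C" if z: "z \<in> cbox p q" for k z
    proof -
      have "norm (f (Y k) z - f x z) \<le> C * norm (Y k - x)"
        by (rule field_differentiable_bound[where S = "{c<..}" and f' = "\<lambda>y. f' y z"])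
           (use z Y \<open>c < x\<close> bound in \<open>auto intro!: DERIV_subset[OF deriv]\<close>)
      then show ?thesis
        using Y by (simp add: divide_le_eq)
    qed
    show "(\<lambda>k. (f (Y k) z - f x z) / (Y k - x)) \<longlonglongrightarrow> f' x z" if z: "z \<in> cbox p q" for z
    proof -
      have "((\<lambda>y. (f y z - f x z) / (y - x)) \<longlongrightarrow> f' x z) (at x)"
        using deriv[OF \<open>c < x\<close> z] by (simp add: has_field_derivative_iff)
      then show ?thesis
        by (rule filterlim_compose) (use Y limY in \<open>auto simp: filterlim_at\<close>)
    qed
  qed
  also have "(\<lambda>i. integral (cbox p q) (\<lambda>z. (f (Y i) z - f x z) / (Y i - x))) =
      (\<lambda>i. (integral (cbox p q) (f (Y i)) - integral (cbox p q) (f x)) / (Y i - x))"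
    using Y \<open>c < x\<close> int by (simp add: divide_inverse integral_diff)
  finally have "(\<lambda>i. ((\<lambda>y. (integral (cbox p q) (f y) - integral (cbox p q) (f x)) / (y - x)) \<circ> X)
      (i + m)) \<longlonglongrightarrow> integral (cbox p q) (f' x)"
    by (simp add: Y_def)
  then show "((\<lambda>y. (integral (cbox p q) (f y) - integral (cbox p q) (f x)) / (y - x)) \<circ> X)
      \<longlonglongrightarrow> integral (cbox p q) (f' x)"
    by (rule LIMSEQ_offset)
qed

text \<open>Fubini, then the fundamental theorem in \<open>s\<close> and in \<open>r\<close>. The
  outer step works with the Henstock-Kurzweil integral, for which existence of the derivative
  \<open>f_r\<close> everywhere suffices.\<close>

lemma integral_mixed_derivative:
  fixes f :: "real \<Rightarrow> real \<Rightarrow> real"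
  assumes "a \<le> b" "c \<le> d"
    and f_r: "\<And>r s. r \<in> {a..b} \<Longrightarrow> s \<in> {c..d} \<Longrightarrow> ((\<lambda>r. f r s) has_real_derivative f_r r s) (at r)"
    and f_rs: "\<And>r s. r \<in> {a..b} \<Longrightarrow> s \<in> {c..d} \<Longrightarrow> (f_r r has_real_derivative f_rs r s) (at s)"
    and cont: "continuous_on ({a..b} \<times> {c..d}) (\<lambda>(r, s). f_rs r s)"
  shows "integral (cbox (a, c) (b, d)) (\<lambda>(r, s). f_rs r s) = f b d - f a d - f b c + f a c"
proof -
  have inner: "integral {c..d} (f_rs r) = f_r r d - f_r r c" if "r \<in> {a..b}" for r
    using that assms
    by (intro integral_unique fundamental_theorem_of_calculus)
       (auto simp: has_real_derivative_iff_has_vector_derivative[symmetric]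
             intro!: DERIV_subset[OF f_rs])
  have "integral (cbox (a, c) (b, d)) (\<lambda>(r, s). f_rs r s) =
      integral {a..b} (\<lambda>r. integral {c..d} (f_rs r))"
    using cont by (subst integral_prod_continuous) (auto simp: cbox_Pair_eq)
  also have "\<dots> = integral {a..b} (\<lambda>r. f_r r d - f_r r c)"
    by (intro Henstock_Kurzweil_Integration.integral_cong inner)
  also have "\<dots> = (f b d - f b c) - (f a d - f a c)"
    using assms
    by (intro integral_unique fundamental_theorem_of_calculus)
       (auto simp: has_real_derivative_iff_has_vector_derivative[symmetric]
             intro!: DERIV_subset[OF DERIV_diff] f_r)
  finally show ?thesis by simp
qed

section \<open>Integration over time rectangles\<close>

text \<open>
  The integral of \<open>u\<close> over \<open>[0, t1] \<times> [0, t2]\<close>, rescaled to the unit square so that the domain of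
  integration does not depend on \<open>t1\<close> and \<open>t2\<close>.
\<close>

definition time_integral :: "(real \<Rightarrow> real \<Rightarrow> real) \<Rightarrow> real \<Rightarrow> real \<Rightarrow> real" where
  "time_integral u t1 t2 =
     t1 * t2 * integral (cbox (0, 0) (1, 1)) (\<lambda>z. u (t1 * fst z) (t2 * snd z))"

lemma continuous_on_rescaled:
  fixes u :: "real \<Rightarrow> real \<Rightarrow> real"
  assumes "continuous_on ({0..} \<times> {0..}) (\<lambda>(r, s). u r s)"
  shows "continuous_on (({0..} \<times> {0..}) \<times> cbox (0, 0) (1, 1))
           (\<lambda>(t, z). u (fst t * fst z) (snd t * snd z))"
proof -
  have "continuous_on (({0..} \<times> {0..}) \<times> cbox (0, 0) (1, 1))
      (\<lambda>p. (\<lambda>(r, s). u r s)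
        (fst (fst p) * fst (snd p) :: real, snd (fst p) * snd (snd p) :: real))"
    by (rule continuous_on_compose2[OF assms])
       (auto intro!: continuous_intros simp: cbox_Pair_eq)
  then show ?thesis by (simp add: split_beta)
qed

lemma continuous_on_rescaled_section:
  fixes u :: "real \<Rightarrow> real \<Rightarrow> real"
  assumes "continuous_on ({0..} \<times> {0..}) (\<lambda>(r, s). u r s)" "0 \<le> t1" "0 \<le> t2"
  shows "continuous_on (cbox (0, 0) (1, 1)) (\<lambda>z. u (t1 * fst z) (t2 * snd z))"
proof -
  have "continuous_on (cbox (0, 0) (1, 1))
      (\<lambda>z. (\<lambda>(t, z). u (fst t * fst z) (snd t * snd z)) ((t1, t2), z :: real \<times> real))"
    by (rule continuous_on_compose2[OF continuous_on_rescaled[OF assms(1)]])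
       (use assms(2,3) in \<open>auto intro!: continuous_intros\<close>)
  then show ?thesis by simp
qed

lemma continuous_on_time_integral:
  assumes "continuous_on ({0..} \<times> {0..}) (\<lambda>(r, s). u r s)"
  shows "continuous_on ({0..} \<times> {0..}) (\<lambda>(r, s). time_integral u r s)"
proof -
  have "continuous_on ({0..} \<times> {0..})
      (\<lambda>t. integral (cbox (0, 0) (1, 1)) (\<lambda>z. u (fst t * fst z) (snd t * snd z)))"
    by (rule integral_continuous_on_param[OF continuous_on_rescaled[OF assms]])
  then show ?thesis
    unfolding time_integral_def split_beta by (intro continuous_intros)
qed

lemma has_integral_power_unit: "((\<lambda>x :: real. x ^ k) has_integral 1 / (real k + 1)) {0..1}"
proof -
  have "((\<lambda>x :: real. x ^ k) has_integral (1 ^ Suc k / (real k + 1) - 0 ^ Suc k / (real k + 1))) {0..1}"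
  proof (rule fundamental_theorem_of_calculus)
    fix x :: real
    have "((\<lambda>x. x ^ Suc k / (real k + 1)) has_real_derivative (real k + 1) * x ^ k / (real k + 1))
        (at x within {0..1})"
      using DERIV_pow[of "Suc k" x "{0..1}"] by (intro DERIV_cdivide) (simp add: add.commute)
    then show "((\<lambda>x. x ^ Suc k / (real k + 1)) has_vector_derivative x ^ k) (at x within {0..1})"
      by (simp add: has_real_derivative_iff_has_vector_derivative)
  qed simp
  then show ?thesis by simp
qed

lemma integral_power_unit_square:
  "integral (cbox (0, 0) (1, 1)) (\<lambda>z. C * (fst z ^ k * snd z ^ k)) = C / (real k + 1)\<^sup>2"
proof -
  have "integral (cbox (0, 0) (1, 1)) (\<lambda>z :: real \<times> real. C * (fst z ^ k * snd z ^ k)) =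
      integral (cbox 0 1) (\<lambda>x. integral (cbox 0 1) (\<lambda>y. C * (x ^ k * y ^ k)))"
    by (subst integral_prod_continuous) (auto intro!: continuous_intros)
  also have "\<dots> = C / (real k + 1)\<^sup>2"
    using integral_unique[OF has_integral_power_unit[of k]]
    by (simp add: power2_eq_square)
  finally show ?thesis .
qed

text \<open>Rescaling pulls out the powers of \<open>t1 * t2\<close> and leaves a monomial on the
  unit square. Its integral has one factor \<open>1 / (k + 1)\<close> per time variable, the source
  of the squared factorial in the bound on the iterates.\<close>

lemma abs_time_integral_le:
  assumes cont: "continuous_on ({0..} \<times> {0..}) (\<lambda>(r, s). u r s)"
    and bound: "\<And>r s. 0 \<le> r \<Longrightarrow> 0 \<le> s \<Longrightarrow> \<bar>u r s\<bar> \<le> C * (r * s) ^ k"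
    and "0 \<le> t1" "0 \<le> t2"
  shows "\<bar>time_integral u t1 t2\<bar> \<le> C * (t1 * t2) ^ Suc k / (real k + 1)\<^sup>2"
proof -
  have "\<bar>integral (cbox (0, 0) (1, 1)) (\<lambda>z. u (t1 * fst z) (t2 * snd z))\<bar>
      \<le> integral (cbox (0, 0) (1, 1)) (\<lambda>z. C * (t1 * t2) ^ k * (fst z ^ k * snd z ^ k))"
    unfolding real_norm_def[symmetric]
  proof (rule integral_norm_bound_integral)
    show "(\<lambda>z. u (t1 * fst z) (t2 * snd z)) integrable_on cbox (0, 0) (1, 1)"
      by (intro integrable_continuous continuous_on_rescaled_section cont assms)
    show "(\<lambda>z :: real \<times> real. C * (t1 * t2) ^ k * (fst z ^ k * snd z ^ k)) integrable_on
        cbox (0, 0) (1, 1)"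
      by (intro integrable_continuous continuous_intros)
    show "norm (u (t1 * fst z) (t2 * snd z)) \<le> C * (t1 * t2) ^ k * (fst z ^ k * snd z ^ k)"
      if "z \<in> cbox (0, 0) (1, 1)" for z
      using bound[of "t1 * fst z" "t2 * snd z"] that assms(3,4)
      by (auto simp: cbox_Pair_eq power_mult_distrib mult_ac)
  qed
  also have "\<dots> = C * (t1 * t2) ^ k / (real k + 1)\<^sup>2"
    by (rule integral_power_unit_square)
  finally have "t1 * t2 * \<bar>integral (cbox (0, 0) (1, 1)) (\<lambda>z. u (t1 * fst z) (t2 * snd z))\<bar>
      \<le> t1 * t2 * (C * (t1 * t2) ^ k / (real k + 1)\<^sup>2)"
    using assms(3,4) by (intro mult_left_mono) auto
  then show ?thesis
    using assms(3,4) by (simp add: time_integral_def abs_mult mult_ac)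
qed

section \<open>The bounded characteristic problem\<close>

text \<open>
  The equation \<open>\<partial>\<^sub>1\<partial>\<^sub>2 q = \<partial>\<^sub>\<tau> q\<close> with zero data on the axes. Nothing is prescribed in the
  \<open>\<tau>\<close>-direction; boundedness takes the place of initial data.
\<close>

locale goursat =
  fixes q q1 q12 :: "real \<Rightarrow> real \<Rightarrow> real \<Rightarrow> real" and c B :: real
  assumes cont: "\<And>\<tau>. c < \<tau> \<Longrightarrow> continuous_on ({0..} \<times> {0..}) (\<lambda>(r, s). q \<tau> r s)"
    and axes: "\<And>\<tau> t. c < \<tau> \<Longrightarrow> 0 \<le> t \<Longrightarrow> q \<tau> 0 t = 0 \<and> q \<tau> t 0 = 0"
    and deriv1: "\<And>\<tau> r s. c < \<tau> \<Longrightarrow> 0 < r \<Longrightarrow> 0 < s \<Longrightarrow>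
      ((\<lambda>r. q \<tau> r s) has_real_derivative q1 \<tau> r s) (at r)"
    and deriv12: "\<And>\<tau> r s. c < \<tau> \<Longrightarrow> 0 < r \<Longrightarrow> 0 < s \<Longrightarrow>
      (q1 \<tau> r has_real_derivative q12 \<tau> r s) (at s)"
    and cont12: "continuous_on ({c<..} \<times> {0<..} \<times> {0<..}) (\<lambda>(\<tau>, r, s). q12 \<tau> r s)"
    and deriv_param: "\<And>\<tau> r s. c < \<tau> \<Longrightarrow> 0 < r \<Longrightarrow> 0 < s \<Longrightarrow>
      ((\<lambda>\<tau>. q \<tau> r s) has_real_derivative q12 \<tau> r s) (at \<tau>)"
    and bound: "\<And>\<tau> r s. c < \<tau> \<Longrightarrow> 0 \<le> r \<Longrightarrow> 0 \<le> s \<Longrightarrow> \<bar>q \<tau> r s\<bar> \<le> B"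
begin

text \<open>
  Near the axes \<open>q12\<close> need not be integrable, so the rectangle is approached from inside, where
  the integral of \<open>q12\<close> is a rectangular increment of \<open>q\<close> and hence bounded.
\<close>

lemma time_integral_has_real_derivative_interior:
  assumes "c < x" and t: "0 < t1" "0 < t2"
  shows "((\<lambda>\<tau>. time_integral (q \<tau>) t1 t2) has_real_derivative q x t1 t2) (at x)"
proof -
  \<comment> \<open>The sequence starts at 1/2, so every inner rectangle lies in the unit square and
    away from the axes.\<close>
  define e where "e n = inverse (real (Suc (Suc n)))" for n
  have e: "0 < e n" "e n < 1" for n by (auto simp: e_def field_simps)
  have e_lim: "e \<longlonglongrightarrow> 0"
    unfolding e_def by (rule LIMSEQ_Suc[OF LIMSEQ_inverse_real_of_nat])
  define F where
    "F n \<tau> = t1 * t2 * integral (cbox (e n, e n) (1, 1)) (\<lambda>z. q \<tau> (t1 * fst z) (t2 * snd z))" for n \<tau>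
  \<comment> \<open>The rectangular increment of \<open>q \<tau>\<close> with lower corner
    \<open>(t1 * e n, t2 * e n)\<close>: it equals the integral of \<open>q12 \<tau>\<close> over
    the inner rectangle, hence the parameter derivative of \<open>F n\<close>.\<close>
  define g where
    "g n \<tau> = q \<tau> t1 t2 - q \<tau> (t1 * e n) t2 - q \<tau> t1 (t2 * e n) + q \<tau> (t1 * e n) (t2 * e n)" for n \<tau>
  have sub: "cbox (e n, e n) (1, 1) \<subseteq> cbox (0, 0) (1, 1)" for n
    using e[of n] by (auto simp: cbox_Pair_eq)
  have cont_resc: "continuous_on (cbox (0, 0) (1, 1)) (\<lambda>z. q \<tau> (t1 * fst z) (t2 * snd z))"
    if "c < \<tau>" for \<tau>
    using t by (intro continuous_on_rescaled_section cont that) auto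
  show ?thesis
  proof (rule derivative_of_bounded_limit)
    show "(F n has_real_derivative g n \<tau>) (at \<tau>)" if \<tau>: "c < \<tau>" for n \<tau>
    proof -
      let ?Q = "cbox (e n, e n) (1, 1)"
      have cont12': "continuous_on ({c<..} \<times> ?Q) (\<lambda>(\<tau>, z). q12 \<tau> (t1 * fst z) (t2 * snd z))"
      proof -
        have "continuous_on ({c<..} \<times> ?Q)
            (\<lambda>p. (\<lambda>(\<tau>, r, s). q12 \<tau> r s) (fst p, t1 * fst (snd p), t2 * snd (snd p)))"
          by (rule continuous_on_compose2[OF cont12])
             (use e[of n] t in \<open>auto intro!: continuous_intros mult_pos_pos simp: cbox_Pair_eq\<close>)
        then show ?thesis by (simp add: split_beta)
      qed
      have "((\<lambda>\<tau>. integral ?Q (\<lambda>z. q \<tau> (t1 * fst z) (t2 * snd z))) has_real_derivative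
          integral ?Q (\<lambda>z. q12 \<tau> (t1 * fst z) (t2 * snd z))) (at \<tau> within {c<..})"
      proof (rule leibniz_rule_field_derivative[OF _ _ cont12'])
        show "((\<lambda>\<tau>. q \<tau> (t1 * fst z) (t2 * snd z)) has_real_derivative
            q12 \<tau> (t1 * fst z) (t2 * snd z)) (at \<tau> within {c<..})" if "\<tau> \<in> {c<..}" "z \<in> ?Q" for \<tau> z
          by (rule DERIV_subset[OF deriv_param])
             (use that e[of n] t in \<open>auto intro!: mult_pos_pos simp: cbox_Pair_eq\<close>)
        show "(\<lambda>z. q \<tau> (t1 * fst z) (t2 * snd z)) integrable_on ?Q" if "\<tau> \<in> {c<..}" for \<tau>
          using that
          by (intro integrable_continuous continuous_on_subset[OF cont_resc sub]) auto
      qed (use \<tau> in auto)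
      then have "((\<lambda>\<tau>. integral ?Q (\<lambda>z. q \<tau> (t1 * fst z) (t2 * snd z))) has_real_derivative
          integral ?Q (\<lambda>z. q12 \<tau> (t1 * fst z) (t2 * snd z))) (at \<tau>)"
        using \<tau> by (simp add: at_within_open[of \<tau> "{c<..}"])
      then have "(F n has_real_derivative
          t1 * t2 * integral ?Q (\<lambda>z. q12 \<tau> (t1 * fst z) (t2 * snd z))) (at \<tau>)"
        unfolding F_def by (rule DERIV_cmult)
      also have "t1 * t2 * integral ?Q (\<lambda>z. q12 \<tau> (t1 * fst z) (t2 * snd z)) =
          integral ?Q (\<lambda>(r, s). t1 * t2 * q12 \<tau> (t1 * r) (t2 * s))"
        unfolding split_beta by (rule Henstock_Kurzweil_Integration.integral_mult_right[symmetric])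
      also have "\<dots> = q \<tau> (t1 * 1) (t2 * 1) - q \<tau> (t1 * e n) (t2 * 1)
          - q \<tau> (t1 * 1) (t2 * e n) + q \<tau> (t1 * e n) (t2 * e n)"
      proof (rule integral_mixed_derivative[where f_r = "\<lambda>r s. t1 * q1 \<tau> (t1 * r) (t2 * s)"])
        fix r s assume rs: "r \<in> {e n..1}" "s \<in> {e n..1}"
        then have pos: "0 < t1 * r" "0 < t2 * s" using e[of n] t by auto
        have "((\<lambda>r. q \<tau> (t1 * r) (t2 * s)) has_real_derivative q1 \<tau> (t1 * r) (t2 * s) * t1) (at r)"
          by (rule DERIV_chain'[where f = "\<lambda>r. t1 * r" and g = "\<lambda>r. q \<tau> r (t2 * s)"])
             (use deriv1[OF \<tau> pos] in \<open>auto intro!: derivative_eq_intros\<close>)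
        then show "((\<lambda>r. q \<tau> (t1 * r) (t2 * s)) has_real_derivative t1 * q1 \<tau> (t1 * r) (t2 * s)) (at r)"
          by (simp add: mult.commute)
        have "((\<lambda>s. q1 \<tau> (t1 * r) (t2 * s)) has_real_derivative q12 \<tau> (t1 * r) (t2 * s) * t2) (at s)"
          by (rule DERIV_chain'[where f = "\<lambda>s. t2 * s" and g = "q1 \<tau> (t1 * r)"])
             (use deriv12[OF \<tau> pos] in \<open>auto intro!: derivative_eq_intros\<close>)
        then have "((\<lambda>s. t1 * q1 \<tau> (t1 * r) (t2 * s)) has_real_derivative
            t1 * (q12 \<tau> (t1 * r) (t2 * s) * t2)) (at s)"
          by (rule DERIV_cmult)
        then show "((\<lambda>s. t1 * q1 \<tau> (t1 * r) (t2 * s)) has_real_derivative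
            t1 * t2 * q12 \<tau> (t1 * r) (t2 * s)) (at s)"
          by (simp add: mult_ac)
      next
        have "continuous_on ({e n..1} \<times> {e n..1})
            (\<lambda>z. (\<lambda>(\<tau>, z). q12 \<tau> (t1 * fst z) (t2 * snd z)) (\<tau>, z))"
          by (rule continuous_on_compose2[OF cont12'])
             (use \<tau> in \<open>auto intro!: continuous_intros simp: cbox_Pair_eq\<close>)
        then show "continuous_on ({e n..1} \<times> {e n..1}) (\<lambda>(r, s). t1 * t2 * q12 \<tau> (t1 * r) (t2 * s))"
          by (auto simp: split_beta intro!: continuous_intros)
      qed (use e[of n] in auto)
      finally show ?thesis by (simp add: g_def)
    qed
    show "\<bar>g n \<tau>\<bar> \<le> 4 * B" if \<tau>: "c < \<tau>" for n \<tau>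
      using bound[OF \<tau>, of t1 t2] bound[OF \<tau>, of "t1 * e n" t2] bound[OF \<tau>, of t1 "t2 * e n"]
        bound[OF \<tau>, of "t1 * e n" "t2 * e n"] t e[of n]
      unfolding g_def by (simp add: abs_le_iff)
    show "(\<lambda>n. F n \<tau>) \<longlonglongrightarrow> time_integral (q \<tau>) t1 t2" if \<tau>: "c < \<tau>" for \<tau>
      unfolding F_def time_integral_def
    proof (rule tendsto_mult[OF tendsto_const])
      let ?f = "\<lambda>z. q \<tau> (t1 * fst z) (t2 * snd z)"
      have "(\<lambda>n. integral (cbox (0, 0) (1, 1)) (\<lambda>z. if z \<in> cbox (e n, e n) (1, 1) then ?f z else 0))
          \<longlonglongrightarrow> integral (cbox (0, 0) (1, 1)) ?f"
      proof (rule dominated_convergence(2))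
        show "(\<lambda>z. if z \<in> cbox (e k, e k) (1, 1) then ?f z else 0) integrable_on cbox (0, 0) (1, 1)" for k
          unfolding integrable_restrict_Int Int_absorb2[OF sub]
          by (intro integrable_continuous continuous_on_subset[OF cont_resc sub] \<tau>)
        show "(\<lambda>_. B) integrable_on cbox (0 :: real, 0 :: real) (1, 1)"
          by (rule integrable_const)
        show "norm (if z \<in> cbox (e k, e k) (1, 1) then ?f z else 0) \<le> B"
          if "z \<in> cbox (0, 0) (1, 1)" for k z
          using bound[OF \<tau>, of "t1 * fst z" "t2 * snd z"] that t by (auto simp: cbox_Pair_eq)
        show "(\<lambda>k. if z \<in> cbox (e k, e k) (1, 1) then ?f z else 0) \<longlonglongrightarrow> ?f z"
          if z: "z \<in> cbox (0, 0) (1, 1)" for z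
        \<comment> \<open>A point on an axis belongs to none of the inner rectangles, so the
          truncated values are constantly 0. The limit is still right because \<open>q\<close>
          vanishes there.\<close>
        proof (cases "fst z = 0 \<or> snd z = 0")
          case True
          then have "?f z = 0"
            using axes[OF \<tau>] z t by (auto simp: cbox_Pair_eq)
          then have "(\<lambda>k. if z \<in> cbox (e k, e k) (1, 1) then ?f z else 0) = (\<lambda>_. ?f z)"
            by (auto simp: fun_eq_iff)
          then show ?thesis by (simp only: tendsto_const)
        next
          case False
          with z have "0 < min (fst z) (snd z)" by (auto simp: cbox_Pair_eq)
          from order_tendstoD(2)[OF e_lim this]
          have "eventually (\<lambda>k. (if z \<in> cbox (e k, e k) (1, 1) then ?f z else 0) = ?f z) sequentially"
            by eventually_elim (use z in \<open>auto simp: cbox_Pair_eq\<close>)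
          then show ?thesis by (rule tendsto_eventually)
        qed
      qed
      then show "(\<lambda>n. integral (cbox (e n, e n) (1, 1)) ?f) \<longlonglongrightarrow> integral (cbox (0, 0) (1, 1)) ?f"
        unfolding integral_restrict_Int Int_absorb2[OF sub] .
    qed
    show "(\<lambda>n. g n \<tau>) \<longlonglongrightarrow> q \<tau> t1 t2" if \<tau>: "c < \<tau>" for \<tau>
    proof -
      have lim: "(\<lambda>n. q \<tau> (a n) (b n)) \<longlonglongrightarrow> q \<tau> a' b'"
        if "a \<longlonglongrightarrow> a'" "b \<longlonglongrightarrow> b'" "\<And>n. 0 \<le> a n" "\<And>n. 0 \<le> b n" "0 \<le> a'" "0 \<le> b'" for a b a' b'
      proof -
        have "(\<lambda>n. (\<lambda>(r, s). q \<tau> r s) (a n, b n)) \<longlonglongrightarrow> (\<lambda>(r, s). q \<tau> r s) (a', b')"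
          by (rule continuous_on_tendsto_compose[OF cont[OF \<tau>] tendsto_Pair])
             (use that in auto)
        then show ?thesis by simp
      qed
      have e1: "(\<lambda>n. t1 * e n) \<longlonglongrightarrow> 0" and e2: "(\<lambda>n. t2 * e n) \<longlonglongrightarrow> 0"
        using e_lim by (auto intro: tendsto_mult_right_zero)
      have "(\<lambda>n. g n \<tau>) \<longlonglongrightarrow> q \<tau> t1 t2 - q \<tau> 0 t2 - q \<tau> t1 0 + q \<tau> 0 0"
        unfolding g_def
        by (intro tendsto_intros lim e1 e2) (use e t in \<open>auto intro: less_imp_le\<close>)
      then show ?thesis using axes[OF \<tau>] t by simp
    qed
    show "continuous_on {c<..} (\<lambda>\<tau>. q \<tau> t1 t2)"
      by (intro continuous_at_imp_continuous_on ballI DERIV_isCont[OF deriv_param]) (use t in auto)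
  qed fact
qed

definition iterated where "iterated k \<tau> = (time_integral ^^ k) (q \<tau>)"

lemma iterated_simps [simp]:
  "iterated 0 \<tau> = q \<tau>" "iterated (Suc k) \<tau> = time_integral (iterated k \<tau>)"
  by (auto simp: iterated_def)

lemma continuous_on_iterated:
  "c < \<tau> \<Longrightarrow> continuous_on ({0..} \<times> {0..}) (\<lambda>(r, s). iterated k \<tau> r s)"
  by (induction k) (auto intro: cont continuous_on_time_integral)

lemma abs_iterated_le:
  assumes "c < \<tau>" "0 \<le> r" "0 \<le> s"
  shows "\<bar>iterated k \<tau> r s\<bar> \<le> B * (r * s) ^ k / (fact k)\<^sup>2"
  using assms(2,3)
proof (induction k arbitrary: r s)
  case (Suc k)
  have "\<bar>time_integral (iterated k \<tau>) r s\<bar> \<le> (B / (fact k)\<^sup>2) * (r * s) ^ Suc k / (real k + 1)\<^sup>2"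
    by (rule abs_time_integral_le[OF continuous_on_iterated[OF assms(1)]])
       (use Suc.IH Suc.prems in auto)
  then show ?case by (simp add: power_mult_distrib mult_ac add.commute)
qed (use assms(1) bound in auto)

text \<open>The differential equation enters only for \<open>k = 0\<close>. Every later step
  differentiates under the integral sign, dominated by the bound on \<open>iterated k\<close>, which
  does not depend on \<open>\<tau>\<close>.\<close>

lemma iterated_has_real_derivative:
  assumes "c < x" "0 \<le> t1" "0 \<le> t2"
  shows "((\<lambda>\<tau>. iterated (Suc k) \<tau> t1 t2) has_real_derivative iterated k x t1 t2) (at x)"
  using assms
proof (induction k arbitrary: x t1 t2)
  case 0
  show ?case
  proof (cases "t1 = 0 \<or> t2 = 0")
    case True
    then have "q x t1 t2 = 0" "(\<lambda>\<tau>. time_integral (q \<tau>) t1 t2) = (\<lambda>_. 0)"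
      using axes 0 by (auto simp: time_integral_def)
    then show ?thesis by simp
  next
    case False
    then show ?thesis
      using 0 time_integral_has_real_derivative_interior by simp
  qed
next
  case (Suc k)
  note t = \<open>0 \<le> t1\<close> \<open>0 \<le> t2\<close>
  have "((\<lambda>\<tau>. integral (cbox (0, 0) (1, 1)) (\<lambda>z. iterated (Suc k) \<tau> (t1 * fst z) (t2 * snd z)))
      has_real_derivative
      integral (cbox (0, 0) (1, 1)) (\<lambda>z. iterated k x (t1 * fst z) (t2 * snd z))) (at x)"
  proof (rule integral_has_real_derivative_dominated[where c = c])
    fix y and z :: "real \<times> real" assume y: "c < y" and z: "z \<in> cbox (0, 0) (1, 1)"
    have rs: "0 \<le> t1 * fst z" "0 \<le> t2 * snd z" "t1 * fst z \<le> t1" "t2 * snd z \<le> t2"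
      using z t by (auto simp: cbox_Pair_eq intro: mult_left_le)
    show "((\<lambda>y. iterated (Suc k) y (t1 * fst z) (t2 * snd z)) has_real_derivative
        iterated k y (t1 * fst z) (t2 * snd z)) (at y)"
      by (rule Suc.IH) (use y rs in auto)
    have "\<bar>iterated k y (t1 * fst z) (t2 * snd z)\<bar>
        \<le> B * ((t1 * fst z) * (t2 * snd z)) ^ k / (fact k)\<^sup>2"
      by (rule abs_iterated_le) (use y rs in auto)
    also have "\<dots> \<le> B * (t1 * t2) ^ k / (fact k)\<^sup>2"
    proof -
      have "((t1 * fst z) * (t2 * snd z)) ^ k \<le> (t1 * t2) ^ k"
        using rs t by (intro power_mono mult_mono) auto
      moreover have "0 \<le> B" using bound[OF y, of 0 0] by simp
      ultimately show ?thesis by (intro divide_right_mono mult_left_mono) auto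
    qed
    finally show "\<bar>iterated k y (t1 * fst z) (t2 * snd z)\<bar> \<le> B * (t1 * t2) ^ k / (fact k)\<^sup>2" .
  next
    show "(\<lambda>z. iterated (Suc k) y (t1 * fst z) (t2 * snd z)) integrable_on cbox (0, 0) (1, 1)"
      if "c < y" for y
      by (intro integrable_continuous continuous_on_rescaled_section continuous_on_iterated that t)
  qed fact
  then show ?case
    unfolding iterated_simps(2)[of "Suc k"] iterated_simps(2)[of k x]
      time_integral_def[of "iterated (Suc k) _"] time_integral_def[of "iterated k x"]
    by (rule DERIV_cmult)
qed

theorem vanishes:
  assumes "c < x" "0 \<le> t1" "0 \<le> t2"
  shows "q x t1 t2 = 0"
proof (cases "t1 = 0 \<or> t2 = 0")
  case True
  then show ?thesis using axes assms by auto
next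
  case False
  with assms have t: "0 < t1" "0 < t2" by auto
  have "iterated 0 x t1 t2 = 0"
  proof (rule vanishing_of_small_antiderivatives[where F = "\<lambda>k \<tau>. iterated k \<tau> t1 t2" and c = c])
    show "\<bar>iterated k y t1 t2\<bar> \<le> B * (t1 * t2) ^ k / (fact k)\<^sup>2" if "c < y" for k y
      by (rule abs_iterated_le) (use that assms in auto)
    show "((\<lambda>\<tau>. iterated (Suc k) \<tau> t1 t2) has_real_derivative iterated k y t1 t2) (at y)"
      if "c < y" for k y
      by (rule iterated_has_real_derivative) (use that assms in auto)
    show "isCont (\<lambda>\<tau>. iterated 0 \<tau> t1 t2) x"
      using DERIV_isCont[OF deriv_param[OF assms(1) t]] by simp
  qed (use assms in auto)
  then show ?thesis by simp
qed

end

section \<open>The generating function of the state probabilities\<close>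

text \<open>The symbol of (I - B)^alpha: on generating functions B is multiplication by z, so the
  fractional difference becomes the product with this series for (1 - z)^alpha.\<close>

definition binomial_fps :: "real \<Rightarrow> real fps" where
  "binomial_fps \<alpha> = Abs_fps (\<lambda>k. (\<alpha> gchoose k) * (- 1) ^ k)"

text \<open>
  The expansion of \<open>exp (- w (1 - z)\<^sup>\<alpha>)\<close> in \<open>z\<close>. The constant term \<open>exp (- w)\<close> is split off because
  the composition of power series requires an inner series without constant term.
\<close>

definition law_fps :: "real \<Rightarrow> real \<Rightarrow> real fps" where
  "law_fps \<alpha> w = fps_const (exp (- w)) * (fps_exp (- w) oo (binomial_fps \<alpha> - 1))"

lemma binomial_fps_nth_0 [simp]: "binomial_fps \<alpha> $ 0 = 1"
  by (simp add: binomial_fps_def)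

lemma binomial_fps_expansion: "(\<lambda>z. (1 - z) powr \<alpha>) has_fps_expansion binomial_fps \<alpha>"
proof (rule has_fps_expansionI)
  have "eventually (\<lambda>z. z \<in> ball 0 1) (nhds (0 :: real))"
    by (intro eventually_nhds_in_open) auto
  then show "eventually (\<lambda>z. (\<lambda>n. binomial_fps \<alpha> $ n * z ^ n) sums (1 - z) powr \<alpha>) (nhds 0)"
  proof eventually_elim
    case (elim z)
    then have "(\<lambda>n. (\<alpha> gchoose n) * (- z) ^ n) sums (1 + - z) powr \<alpha>"
      by (intro gen_binomial_real) auto
    then show ?case
      by (simp add: binomial_fps_def power_minus[of z] mult_ac)
  qed
qed

lemma law_fps_nth_0 [simp]: "law_fps \<alpha> w $ 0 = exp (- w)"
  by (simp add: law_fps_def)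

lemma law_fps_0: "law_fps \<alpha> 0 = 1"
  by (simp add: law_fps_def)

lemma law_fps_deriv: "fps_deriv (law_fps \<alpha> w) = fps_const (- w) * fps_deriv (binomial_fps \<alpha>) * law_fps \<alpha> w"
proof -
  have "fps_deriv (fps_exp (- w) oo (binomial_fps \<alpha> - 1)) =
      (fps_const (- w) * fps_exp (- w) oo (binomial_fps \<alpha> - 1)) * fps_deriv (binomial_fps \<alpha> - 1)"
    by (subst fps_compose_deriv) simp_all
  also have "(fps_const (- w) * fps_exp (- w) oo (binomial_fps \<alpha> - 1)) =
      fps_const (- w) * (fps_exp (- w) oo (binomial_fps \<alpha> - 1))"
    by (subst fps_compose_mult_distrib) simp_all
  finally show ?thesis
    by (simp add: law_fps_def mult_ac)
qed

text \<open>The inner series \<open>C\<close> has no constant term, so each coefficient of the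
  composition is a finite sum and can be differentiated term by term.\<close>

lemma law_fps_nth_has_real_derivative:
  "((\<lambda>w. law_fps \<alpha> w $ n) has_real_derivative - ((binomial_fps \<alpha> * law_fps \<alpha> w) $ n)) (at w)"
proof -
  define C where "C = binomial_fps \<alpha> - 1"
  define E where "E w = fps_exp (- w) oo C" for w
  have C0: "C $ 0 = 0" by (simp add: C_def)
  have "((\<lambda>w. E w $ n) has_real_derivative - ((E w * C) $ n)) (at w)"
  proof -
    \<comment> \<open>Multiplication by \<open>fps_X\<close> expresses the index drop caused by
      differentiation, including the value 0 at \<open>i = 0\<close>. After composition
      \<open>fps_X\<close> becomes \<open>C\<close>.\<close>
    have "((\<lambda>w. fps_exp (- w) $ i * (C ^ i $ n)) has_real_derivative
        - ((fps_exp (- w) * fps_X) $ i) * (C ^ i $ n)) (at w)" for i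
    proof (cases i)
      case (Suc j)
      have "((\<lambda>w. (- w) ^ Suc j / fact (Suc j)) has_real_derivative
          (real (Suc j) * ((- w) ^ j * (- 1))) / fact (Suc j)) (at w)"
        using DERIV_chain'[OF DERIV_minus[OF DERIV_ident] DERIV_pow[of "Suc j" "- w"]]
        by (intro DERIV_cdivide) (simp add: mult_ac del: power_Suc)
      also have "(real (Suc j) * ((- w) ^ j * (- 1))) / fact (Suc j) = - ((- w) ^ j / fact j)"
        by (simp add: divide_simps)
      finally show ?thesis
        unfolding Suc by (intro DERIV_cmult_right) (simp del: power_Suc fact_Suc)
    qed auto
    then have "((\<lambda>w. E w $ n) has_real_derivative
        (\<Sum>i = 0..n. - ((fps_exp (- w) * fps_X) $ i) * (C ^ i $ n))) (at w)"
      unfolding E_def fps_compose_nth by (rule DERIV_sum)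
    also have "(\<Sum>i = 0..n. - ((fps_exp (- w) * fps_X) $ i) * (C ^ i $ n)) =
        - ((fps_exp (- w) * fps_X oo C) $ n)"
      by (simp add: fps_compose_nth sum_negf)
    also have "(fps_exp (- w) * fps_X oo C) = E w * C"
      using C0 by (simp add: fps_compose_mult_distrib E_def)
    finally show ?thesis .
  qed
  moreover have "((\<lambda>w :: real. exp (- w)) has_real_derivative - exp (- w)) (at w)"
    by (auto intro!: derivative_eq_intros)
  ultimately have "((\<lambda>w. exp (- w) * E w $ n) has_real_derivative
      - exp (- w) * E w $ n + - ((E w * C) $ n) * exp (- w)) (at w)"
    by (rule DERIV_mult[rotated])
  moreover have "(\<lambda>w. exp (- w) * E w $ n) = (\<lambda>w. law_fps \<alpha> w $ n)"
    by (simp add: law_fps_def E_def C_def)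
  moreover have "- exp (- w) * E w $ n + - ((E w * C) $ n) * exp (- w) =
      - ((binomial_fps \<alpha> * law_fps \<alpha> w) $ n)"
  proof -
    \<comment> \<open>Here \<open>binomial_fps \<alpha>\<close> is \<open>1 + C\<close>; the summand
      1 comes from differentiating the prefactor \<open>exp (- w)\<close>.\<close>
    have "binomial_fps \<alpha> * law_fps \<alpha> w = fps_const (exp (- w)) * (E w + E w * C)"
      unfolding law_fps_def E_def[symmetric] C_def[symmetric] by (simp add: C_def algebra_simps)
    then show ?thesis
      by (simp only: fps_mult_left_const_nth fps_add_nth) (simp add: algebra_simps)
  qed
  ultimately show ?thesis by simp
qed

text \<open>The terms \<open>exp (- w) * w ^ i / i!\<close> are at most 1, so the bound is
  independent of \<open>w\<close>. This gives boundedness uniformly in \<open>\<tau>\<close>, where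
  \<open>w = r * s / \<tau>\<close>.\<close>

lemma abs_law_fps_nth_le:
  assumes "0 \<le> w"
  shows "\<bar>law_fps \<alpha> w $ n\<bar> \<le> (\<Sum>i = 0..n. \<bar>(binomial_fps \<alpha> - 1) ^ i $ n\<bar>)"
proof -
  have "exp (- w) * (w ^ i / fact i) \<le> 1" for i
  proof -
    have "w ^ i / fact i \<le> exp w"
      by (rule power_div_fact_le_exp[OF assms])
    then show ?thesis
      by (simp add: exp_minus field_simps)
  qed
  then have "exp (- w) * (w ^ i / fact i) * \<bar>(binomial_fps \<alpha> - 1) ^ i $ n\<bar>
      \<le> 1 * \<bar>(binomial_fps \<alpha> - 1) ^ i $ n\<bar>" for i
    by (intro mult_right_mono) auto
  then have "\<bar>exp (- w) * (fps_exp (- w) $ i * ((binomial_fps \<alpha> - 1) ^ i $ n))\<bar>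
      \<le> \<bar>(binomial_fps \<alpha> - 1) ^ i $ n\<bar>" for i
    using assms by (simp add: abs_mult power_abs mult.assoc)
  then have "\<bar>\<Sum>i = 0..n. exp (- w) * (fps_exp (- w) $ i * ((binomial_fps \<alpha> - 1) ^ i $ n))\<bar>
      \<le> (\<Sum>i = 0..n. \<bar>(binomial_fps \<alpha> - 1) ^ i $ n\<bar>)"
    by (intro order_trans[OF sum_abs sum_mono])
  then show ?thesis
    by (simp add: law_fps_def fps_compose_nth sum_distrib_left)
qed

section \<open>Identification of the law by its generating function\<close>

lemma fps_linear_ode_unique:
  fixes E G P :: "real fps"
  assumes "fps_deriv E = P * E" "fps_deriv G = P * G" "E $ 0 = G $ 0"
  shows "E = G"
proof (rule fps_ext)
  show "E $ n = G $ n" for n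
  proof (induction n rule: less_induct)
    case (less n)
    show ?case
    proof (cases n)
      case 0
      then show ?thesis using assms(3) by simp
    next
      case (Suc m)
      \<comment> \<open>Coefficient \<open>m\<close> of the derivative is \<open>m + 1\<close> times
        coefficient \<open>m + 1\<close>, while the right-hand side involves only the coefficients
        up to \<open>m\<close>.\<close>
      have "fps_deriv E $ m = fps_deriv G $ m"
        unfolding assms(1,2) fps_mult_nth using less Suc by (intro sum.cong) auto
      then show ?thesis using Suc by simp
    qed
  qed
qed

lemma has_fps_expansion_transform:
  assumes "f has_fps_expansion F" "eventually (\<lambda>z. f z = g z) (nhds 0)"
  shows "g has_fps_expansion F"
  using assms unfolding has_fps_expansion_def by (auto elim: eventually_elim2)

lemma has_fps_expansion_nth_0: "f has_fps_expansion F \<Longrightarrow> F $ 0 = f 0"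
  unfolding has_fps_expansion_def by (auto dest: eventually_nhds_x_imp_x simp: eval_fps_at_0)

text \<open>For an expansion of zero, the constant term is its value at 0; repeated differentiation
  brings every other coefficient into that position.\<close>

lemma has_fps_expansion_unique:
  fixes E G :: "real fps"
  assumes "f has_fps_expansion E" "f has_fps_expansion G"
  shows "E = G"
proof -
  have "(\<lambda>_. 0) has_fps_expansion H \<Longrightarrow> H $ n = 0" for H :: "real fps" and n
  proof (induction n arbitrary: H)
    case 0
    then show ?case
      using has_fps_expansion_nth_0 by metis
  next
    case (Suc n)
    have "deriv (\<lambda>_. 0 :: real) has_fps_expansion fps_deriv H"
      by (rule has_fps_expansion_deriv[OF Suc.prems])
    then have "(\<lambda>_. 0) has_fps_expansion fps_deriv H"
      by (rule has_fps_expansion_transform) simp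
    from Suc.IH[OF this] show ?case by simp
  qed
  moreover have "(\<lambda>_. 0) has_fps_expansion (E - G)"
    using has_fps_expansion_diff[OF assms] by simp
  ultimately have "(E - G) $ n = 0" for n by blast
  then show ?thesis by (simp add: fps_eq_iff)
qed

text \<open>The sum function satisfies the same linear equation in z as
  \<open>law_fps \<alpha> w\<close>, with the same constant term. The formal composition is thus
  identified without being evaluated.\<close>

lemma law_fps_nth_eqI:
  assumes "\<And>z. \<bar>z\<bar> < 1 \<Longrightarrow> (\<lambda>n. a n * z ^ n) sums exp (- (w * (1 - z) powr \<alpha>))"
  shows "a n = law_fps \<alpha> w $ n"
proof -
  define F :: "real \<Rightarrow> real" where "F z = exp (- (w * (1 - z) powr \<alpha>))" for z
  define E where "E = Abs_fps a"
  have near_0: "eventually (\<lambda>z. z \<in> ball 0 1) (nhds (0 :: real))"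
    by (intro eventually_nhds_in_open) auto
  have F: "F has_fps_expansion E"
  proof (rule has_fps_expansionI)
    show "eventually (\<lambda>z. (\<lambda>n. E $ n * z ^ n) sums F z) (nhds 0)"
      using near_0 by eventually_elim (use assms in \<open>auto simp: E_def F_def\<close>)
  qed
  have deriv_F: "eventually (\<lambda>z. - w * deriv (\<lambda>z. (1 - z) powr \<alpha>) z * F z = deriv F z) (nhds 0)"
    using near_0
  proof eventually_elim
    case (elim z)
    then have "((\<lambda>z. (1 - z) powr \<alpha>) has_real_derivative - \<alpha> * (1 - z) powr (\<alpha> - 1)) (at z)"
      by (auto intro!: derivative_eq_intros)
    \<comment> \<open>The derivative is kept as \<open>deriv\<close> because its expansion is then
      \<open>fps_deriv (binomial_fps \<alpha>)\<close>.\<close>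
    then have D: "((\<lambda>z. (1 - z) powr \<alpha>) has_real_derivative deriv (\<lambda>z. (1 - z) powr \<alpha>) z) (at z)"
      using DERIV_imp_deriv by metis
    have "(F has_real_derivative F z * - (w * deriv (\<lambda>z. (1 - z) powr \<alpha>) z)) (at z)"
      unfolding F_def by (rule derivative_eq_intros DERIV_cmult D refl)+
    then show ?case
      by (simp add: DERIV_imp_deriv mult_ac)
  qed
  have "(\<lambda>z. - w * deriv (\<lambda>z. (1 - z) powr \<alpha>) z * F z) has_fps_expansion
      fps_const (- w) * fps_deriv (binomial_fps \<alpha>) * E"
    by (intro has_fps_expansion_mult has_fps_expansion_cmult_left has_fps_expansion_deriv
        binomial_fps_expansion F)
  then have "deriv F has_fps_expansion fps_const (- w) * fps_deriv (binomial_fps \<alpha>) * E"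
    using deriv_F by (rule has_fps_expansion_transform)
  then have "fps_deriv E = fps_const (- w) * fps_deriv (binomial_fps \<alpha>) * E"
    by (rule has_fps_expansion_unique[OF has_fps_expansion_deriv[OF F]])
  moreover have "E $ 0 = law_fps \<alpha> w $ 0"
    using has_fps_expansion_nth_0[OF F] by (simp add: F_def)
  ultimately have "E = law_fps \<alpha> w"
    by (rule fps_linear_ode_unique[OF _ law_fps_deriv])
  then have "E $ n = law_fps \<alpha> w $ n" by simp
  then show ?thesis by (simp add: E_def)
qed

section \<open>A Poisson process at an independent random time\<close>

definition poisson_weight :: "nat \<Rightarrow> real \<Rightarrow> real" where
  "poisson_weight n w = w ^ n / fact n * exp (- w)"

lemma poisson_weight_bounds: 
  assumes "0 \<le> w"
  shows "0 \<le> poisson_weight n w" "poisson_weight n w \<le> 1"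
proof -
  have "w ^ n / fact n \<le> exp w"
    by (rule power_div_fact_le_exp[OF assms])
  then show "poisson_weight n w \<le> 1"
    by (simp add: poisson_weight_def exp_minus field_simps)
qed (use assms in \<open>simp add: poisson_weight_def\<close>)

lemma poisson_weight_measurable [measurable]: "poisson_weight n \<in> borel_measurable borel"
  unfolding poisson_weight_def by measurable

lemma poisson_weight_generating_function:
  "(\<lambda>n. poisson_weight n w * z ^ n) sums exp (- (w * (1 - z)))"
proof -
  have "(\<lambda>n. exp (- w) * ((w * z) ^ n /\<^sub>R fact n)) sums (exp (- w) * exp (w * z))"
    by (intro sums_mult exp_converges)
  then show ?thesis
    by (simp add: poisson_weight_def power_mult_distrib divide_inverse mult_ac
        exp_add[symmetric] right_diff_distrib)
qed

text \<open>Poisson weights are at most 1, so \<open>\<bar>z\<bar> ^ n\<close> dominates the series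
  and sum and expectation may be exchanged. The result is a Laplace transform of
  \<open>T\<close>.\<close>

lemma (in prob_space) poisson_mixture_generating_function:
  assumes T: "T \<in> borel_measurable M" "AE \<omega> in M. 0 \<le> T \<omega>" and "0 < rate" and z: "\<bar>z\<bar> < 1"
  shows "(\<lambda>n. expectation (\<lambda>\<omega>. poisson_weight n (rate * T \<omega>)) * z ^ n) sums
    expectation (\<lambda>\<omega>. exp (- (rate * (1 - z)) * T \<omega>))"
proof -
  note [measurable] = T(1)
  have bounds: "AE \<omega> in M. 0 \<le> poisson_weight n (rate * T \<omega>) \<and> poisson_weight n (rate * T \<omega>) \<le> 1" for n
    using T(2) by eventually_elim (use poisson_weight_bounds \<open>0 < rate\<close> in auto)
  have bound_z: "AE \<omega> in M. norm (poisson_weight n (rate * T \<omega>) * z ^ n) \<le> \<bar>z\<bar> ^ n" for n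
    using bounds[of n] by eventually_elim (auto simp: abs_mult power_abs mult_left_le_one_le)
  have int: "integrable M (\<lambda>\<omega>. poisson_weight n (rate * T \<omega>) * z ^ n)" for n
    by (rule integrable_const_bound[OF bound_z]) measurable
  have "(\<lambda>n. expectation (\<lambda>\<omega>. poisson_weight n (rate * T \<omega>) * z ^ n)) sums
      expectation (\<lambda>\<omega>. \<Sum>n. poisson_weight n (rate * T \<omega>) * z ^ n)"
  proof (rule sums_integral[OF int])
    have "AE \<omega> in M. \<forall>n. norm (poisson_weight n (rate * T \<omega>) * z ^ n) \<le> \<bar>z\<bar> ^ n"
      using bound_z by (simp add: AE_all_countable)
    then show "AE \<omega> in M. summable (\<lambda>n. norm (poisson_weight n (rate * T \<omega>) * z ^ n))"
    proof eventually_elim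
      case (elim \<omega>)
      show ?case
        by (rule summable_comparison_test[OF _ summable_geometric[of "\<bar>z\<bar>"]]) (use elim z in auto)
    qed
    have "expectation (\<lambda>\<omega>. norm (poisson_weight n (rate * T \<omega>) * z ^ n)) \<le> \<bar>z\<bar> ^ n" for n
      using integral_mono_AE[OF integrable_norm[OF int[of n]] _ bound_z[of n]] by (simp add: prob_space)
    then show "summable (\<lambda>n. expectation (\<lambda>\<omega>. norm (poisson_weight n (rate * T \<omega>) * z ^ n)))"
      by (intro summable_comparison_test[OF _ summable_geometric[of "\<bar>z\<bar>"]]) (use z in auto)
  qed
  moreover have "(\<Sum>n. poisson_weight n (rate * T \<omega>) * z ^ n) = exp (- (rate * (1 - z)) * T \<omega>)" for \<omega>
    using sums_unique[OF poisson_weight_generating_function[of "rate * T \<omega>" z]] by (simp add: mult_ac)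
  ultimately show ?thesis by simp
qed

text \<open>
  The dyadic approximations lie strictly above \<open>t\<close>, as required by the right continuity of the
  paths.
\<close>

lemma dyadic_time:
  fixes t :: real
  defines "d \<equiv> \<lambda>k :: nat. real (Suc (nat \<lfloor>2 ^ k * t\<rfloor>)) / 2 ^ k"
  assumes "0 \<le> t"
  shows "t < d k" "d \<longlonglongrightarrow> t"
proof -
  have gt: "t < d k" and le: "d k \<le> t + (1 / 2) ^ k" for k
  proof -
    have "d k = (of_int \<lfloor>2 ^ k * t\<rfloor> + 1) / 2 ^ k"
      using assms(2) by (simp add: d_def)
    moreover have "2 ^ k * t / 2 ^ k < (of_int \<lfloor>2 ^ k * t\<rfloor> + 1) / 2 ^ k"
      by (rule divide_strict_right_mono) (linarith, simp)
    moreover have "(of_int \<lfloor>2 ^ k * t\<rfloor> + 1) / 2 ^ k \<le> (2 ^ k * t + 1) / 2 ^ k"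
      by (rule divide_right_mono) (linarith, simp)
    moreover have "(2 ^ k * t + 1) / 2 ^ k = t + (1 / 2) ^ k" "2 ^ k * t / 2 ^ k = t"
      by (simp_all add: add_divide_distrib power_one_over)
    ultimately show "t < d k" "d k \<le> t + (1 / 2) ^ k"
      by linarith+
  qed
  show "t < d k" by (rule gt)
  show "d \<longlonglongrightarrow> t"
  proof (rule real_tendsto_sandwich)
    show "eventually (\<lambda>k. t \<le> d k) sequentially" "eventually (\<lambda>k. d k \<le> t + (1 / 2) ^ k) sequentially"
      using gt le by (auto intro!: always_eventually less_imp_le)
    have "(\<lambda>k. t + (1 / 2) ^ k) \<longlonglongrightarrow> t + 0"
      by (intro tendsto_intros LIMSEQ_power_zero) auto
    then show "(\<lambda>k. t + (1 / 2) ^ k) \<longlonglongrightarrow> t" by simp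
  qed simp
qed

text \<open>On \<open>{J = j}\<close> the random time is the constant \<open>g j\<close>, so
  independence at fixed times suffices; the countably many pieces are summed in
  \<open>ennreal\<close>.\<close>

lemma (in prob_space) poisson_at_independent_discrete_time:
  fixes N :: "real \<Rightarrow> 'a \<Rightarrow> nat" and J :: "'a \<Rightarrow> nat"
  assumes N: "\<And>t. 0 \<le> t \<Longrightarrow> N t \<in> M \<rightarrow>\<^sub>M count_space UNIV"
    and law: "\<And>t. 0 < t \<Longrightarrow> prob {\<omega> \<in> space M. N t \<omega> = n} = poisson_weight n (rate * t)"
    and J: "J \<in> M \<rightarrow>\<^sub>M count_space UNIV"
    and indep: "\<And>t j. 0 \<le> t \<Longrightarrow> prob ({\<omega> \<in> space M. N t \<omega> = n} \<inter> {\<omega> \<in> space M. J \<omega> = j}) =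
      prob {\<omega> \<in> space M. N t \<omega> = n} * prob {\<omega> \<in> space M. J \<omega> = j}"
    and g: "\<And>j. 0 < g j" and "0 < rate"
  shows "prob {\<omega> \<in> space M. N (g (J \<omega>)) \<omega> = n} = expectation (\<lambda>\<omega>. poisson_weight n (rate * g (J \<omega>)))"
proof -
  note [measurable] = J
  have N' [measurable]: "N (g j) \<in> M \<rightarrow>\<^sub>M count_space UNIV" for j
    using N[of "g j"] g[of j] by simp
  define A where "A j = {\<omega> \<in> space M. N (g j) \<omega> = n} \<inter> {\<omega> \<in> space M. J \<omega> = j}" for j
  have A [measurable]: "A j \<in> events" for j
    unfolding A_def by measurable
  have w: "0 \<le> poisson_weight n (rate * g j)" for j
    using poisson_weight_bounds(1)[of "rate * g j" n] g[of j] \<open>0 < rate\<close> by simp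
  have "emeasure M {\<omega> \<in> space M. N (g (J \<omega>)) \<omega> = n} = emeasure M (\<Union>j. A j)"
    by (rule arg_cong[where f = "emeasure M"]) (auto simp: A_def)
  also have "\<dots> = (\<Sum>j. emeasure M (A j))"
    by (rule suminf_emeasure[symmetric]) (auto simp: disjoint_family_on_def A_def)
  also have "\<dots> = (\<Sum>j. ennreal (poisson_weight n (rate * g j)) * emeasure M {\<omega> \<in> space M. J \<omega> = j})"
  proof (rule suminf_cong)
    fix j
    have "prob (A j) = poisson_weight n (rate * g j) * prob {\<omega> \<in> space M. J \<omega> = j}"
      unfolding A_def using indep[of "g j" j] law[OF g[of j]] g[of j] by simp
    then show "emeasure M (A j) =
        ennreal (poisson_weight n (rate * g j)) * emeasure M {\<omega> \<in> space M. J \<omega> = j}"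
      using w by (simp add: emeasure_eq_measure ennreal_mult)
  qed
  also have "\<dots> = (\<Sum>j. \<integral>\<^sup>+\<omega>. ennreal (poisson_weight n (rate * g j)) *
      indicator {\<omega> \<in> space M. J \<omega> = j} \<omega> \<partial>M)"
    by (subst nn_integral_cmult_indicator) auto
  also have "\<dots> = (\<integral>\<^sup>+\<omega>. (\<Sum>j. ennreal (poisson_weight n (rate * g j)) *
      indicator {\<omega> \<in> space M. J \<omega> = j} \<omega>) \<partial>M)"
    by (rule nn_integral_suminf[symmetric]) measurable
  also have "\<dots> = (\<integral>\<^sup>+\<omega>. ennreal (poisson_weight n (rate * g (J \<omega>))) \<partial>M)"
  proof (rule nn_integral_cong)
    fix \<omega> assume "\<omega> \<in> space M"
    then show "(\<Sum>j. ennreal (poisson_weight n (rate * g j)) * indicator {\<omega> \<in> space M. J \<omega> = j} \<omega>) =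
        ennreal (poisson_weight n (rate * g (J \<omega>)))"
      by (subst suminf_finite[of "{J \<omega>}"]) (auto simp: indicator_def)
  qed
  finally have "emeasure M {\<omega> \<in> space M. N (g (J \<omega>)) \<omega> = n} =
      (\<integral>\<^sup>+\<omega>. ennreal (poisson_weight n (rate * g (J \<omega>))) \<partial>M)" .
  moreover have "(\<lambda>\<omega>. poisson_weight n (rate * g (J \<omega>))) \<in> borel_measurable M"
    using measurable_compose[OF J, of "\<lambda>j. poisson_weight n (rate * g j)" borel] by simp
  ultimately show ?thesis
    using w by (simp add: measure_def integral_eq_nn_integral)
qed

text \<open>Right continuity carries the discrete case over to \<open>T\<close> along dyadic times
  from above; dominated convergence then gives the limit on both sides.\<close>

lemma (in prob_space) poisson_at_independent_time:
  fixes N :: "real \<Rightarrow> 'a \<Rightarrow> nat" and T :: "'a \<Rightarrow> real"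
  assumes N: "\<And>t. 0 \<le> t \<Longrightarrow> N t \<in> M \<rightarrow>\<^sub>M count_space UNIV"
    and law: "\<And>t n. 0 < t \<Longrightarrow> prob {\<omega> \<in> space M. N t \<omega> = n} = poisson_weight n (rate * t)"
    and right_cont: "AE \<omega> in M. \<forall>t\<ge>0. continuous (at_right t) (\<lambda>s. N s \<omega>)"
    and T: "T \<in> borel_measurable M" "AE \<omega> in M. 0 \<le> T \<omega>"
    and indep: "\<And>t n A. 0 \<le> t \<Longrightarrow> A \<in> sets borel \<Longrightarrow>
      prob ({\<omega> \<in> space M. N t \<omega> = n} \<inter> {\<omega> \<in> space M. T \<omega> \<in> A}) =
      prob {\<omega> \<in> space M. N t \<omega> = n} * prob {\<omega> \<in> space M. T \<omega> \<in> A}"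
    and "0 < rate"
  shows "(\<lambda>\<omega>. N (T \<omega>) \<omega>) \<in> completion M \<rightarrow>\<^sub>M count_space UNIV" (is ?meas)
    and "measure (completion M) {\<omega> \<in> space M. N (T \<omega>) \<omega> = n} =
      expectation (\<lambda>\<omega>. poisson_weight n (rate * T \<omega>))" (is "?law n")
proof -
  note [measurable] = T(1)
  \<comment> \<open>Where \<open>T\<close> is negative, \<open>nat\<close> truncates to 0, so the
    dyadic time \<open>D k\<close> is positive everywhere.\<close>
  define J where "J k \<omega> = nat \<lfloor>2 ^ k * T \<omega>\<rfloor>" for k :: nat and \<omega>
  define D where "D k \<omega> = real (Suc (J k \<omega>)) / 2 ^ k" for k \<omega>
  have J [measurable]: "J k \<in> M \<rightarrow>\<^sub>M count_space UNIV" for k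
    unfolding J_def by measurable
  have D [measurable]: "D k \<in> borel_measurable M" for k
    unfolding D_def by measurable
  have [measurable]: "(\<lambda>\<omega>. N (D k \<omega>) \<omega>) \<in> M \<rightarrow>\<^sub>M count_space UNIV" for k
    unfolding D_def
    by (rule measurable_compose_countable'[where I = UNIV and g = "J k" and
          f = "\<lambda>j. N (real (Suc j) / 2 ^ k)"]) (auto intro!: N J)
  \<comment> \<open>An honest event of \<open>M\<close>, since it involves only countably many
    dyadic evaluations. It stands in for \<open>N (T \<omega>) \<omega> = n\<close>, which is
    measurable only up to a null set.\<close>
  define S where "S n = {\<omega> \<in> space M. \<exists>m. \<forall>k\<ge>m. N (D k \<omega>) \<omega> = n}" for n
  have S [measurable]: "S n \<in> events" for n
    unfolding S_def by measurable
  have conv: "AE \<omega> in M. D k \<omega> > 0 \<and> (\<lambda>k. D k \<omega>) \<longlonglongrightarrow> T \<omega> \<and>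
      eventually (\<lambda>k. N (D k \<omega>) \<omega> = N (T \<omega>) \<omega>) sequentially" for k
    using right_cont T(2)
  proof eventually_elim
    case (elim \<omega>)
    have lim: "(\<lambda>k. D k \<omega>) \<longlonglongrightarrow> T \<omega>" and gt: "T \<omega> < D k \<omega>" for k
      using dyadic_time[OF elim(2)] by (auto simp: D_def J_def)
    have "filterlim (\<lambda>k. D k \<omega>) (at_right (T \<omega>)) sequentially"
      using lim gt less_imp_neq[OF gt, symmetric] by (simp add: filterlim_at)
    moreover have "((\<lambda>s. N s \<omega>) \<longlongrightarrow> N (T \<omega>) \<omega>) (at_right (T \<omega>))"
      using elim by (auto simp: continuous_within)
    ultimately have "((\<lambda>k. N (D k \<omega>) \<omega>) \<longlongrightarrow> N (T \<omega>) \<omega>) sequentially"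
      by (rule filterlim_compose[rotated])
    \<comment> \<open>On the discrete space \<open>nat\<close>, convergence means being eventually
      equal to the limit.\<close>
    then have "eventually (\<lambda>k. N (D k \<omega>) \<omega> = N (T \<omega>) \<omega>) sequentially"
      by (simp add: tendsto_discrete)
    then show ?case
      using lim by (auto simp: D_def)
  qed
  have S_eq: "AE \<omega> in M. N (T \<omega>) \<omega> = n \<longleftrightarrow> \<omega> \<in> S n" for n
    using conv[of 0] AE_space
  proof eventually_elim
    case (elim \<omega>)
    then obtain m0 where m0: "\<And>k. k \<ge> m0 \<Longrightarrow> N (D k \<omega>) \<omega> = N (T \<omega>) \<omega>"
      by (auto simp: eventually_sequentially)
    show ?case
    proof
      assume "N (T \<omega>) \<omega> = n"
      then show "\<omega> \<in> S n" using m0 elim by (auto simp: S_def)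
    next
      assume "\<omega> \<in> S n"
      then obtain m where "\<And>k. k \<ge> m \<Longrightarrow> N (D k \<omega>) \<omega> = n" by (auto simp: S_def)
      from this[of "max m m0"] m0[of "max m m0"] show "N (T \<omega>) \<omega> = n" by simp
    qed
  qed
  have meas_n: "{\<omega> \<in> space M. N (T \<omega>) \<omega> = n} \<in> sets (completion M)" for n
  proof -
    have "AE \<omega> in M. \<not> \<not> (N (T \<omega>) \<omega> = n \<longleftrightarrow> \<omega> \<in> S n)"
      using S_eq[of n] by simp
    from sets_completion_AE[OF this]
    have "{\<omega> \<in> space M. \<not> (N (T \<omega>) \<omega> = n \<longleftrightarrow> \<omega> \<in> S n)} \<in> sets (completion M)" (is "?B \<in> _")
      by (simp add: pred_def)
    moreover have "S n \<in> sets (completion M)"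
      using S[of n] by (rule sets_completionI_sets)
    \<comment> \<open>The event in question is the symmetric difference of \<open>S n\<close> and
      the exceptional null set \<open>?B\<close>.\<close>
    ultimately have "(S n - ?B) \<union> (?B - S n) \<in> sets (completion M)"
      by (intro sets.Un sets.Diff)
    also have "(S n - ?B) \<union> (?B - S n) = {\<omega> \<in> space M. N (T \<omega>) \<omega> = n}"
      by (auto simp: S_def)
    finally show ?thesis .
  qed
  show ?meas
    by (rule measurable_count_space_eq2_countable[THEN iffD2])
       (use meas_n in \<open>auto simp: vimage_def Int_def conj_commute\<close>)
  have "prob (S n) = expectation (\<lambda>\<omega>. poisson_weight n (rate * T \<omega>))"
  proof (rule LIMSEQ_unique)
    have "(\<lambda>k. expectation (indicator {\<omega> \<in> space M. N (D k \<omega>) \<omega> = n})) \<longlonglongrightarrow>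
        expectation (indicator (S n) :: _ \<Rightarrow> real)"
    proof (rule integral_dominated_convergence[where w = "\<lambda>_. 1"])
      show "AE \<omega> in M. (\<lambda>k. indicator {\<omega> \<in> space M. N (D k \<omega>) \<omega> = n} \<omega> :: real)
          \<longlonglongrightarrow> indicator (S n) \<omega>"
        using conv[of 0] S_eq[of n] AE_space
      proof eventually_elim
        case (elim \<omega>)
        then have "eventually (\<lambda>k. N (D k \<omega>) \<omega> = N (T \<omega>) \<omega>) sequentially" by simp
        then have "eventually (\<lambda>k. indicator {\<omega> \<in> space M. N (D k \<omega>) \<omega> = n} \<omega> =
            (indicator (S n) \<omega> :: real)) sequentially"
          by eventually_elim (use elim in \<open>auto simp: indicator_def\<close>)
        then show ?case by (rule tendsto_eventually)
      qed
    qed (auto simp: indicator_def)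
    then show "(\<lambda>k. prob {\<omega> \<in> space M. N (D k \<omega>) \<omega> = n}) \<longlonglongrightarrow> prob (S n)"
      by simp
    have "(\<lambda>k. expectation (\<lambda>\<omega>. poisson_weight n (rate * D k \<omega>))) \<longlonglongrightarrow>
        expectation (\<lambda>\<omega>. poisson_weight n (rate * T \<omega>))"
    proof (rule integral_dominated_convergence[where w = "\<lambda>_. 1"])
      show "AE \<omega> in M. (\<lambda>k. poisson_weight n (rate * D k \<omega>)) \<longlonglongrightarrow> poisson_weight n (rate * T \<omega>)"
        using conv[of 0]
        by eventually_elim (auto simp: poisson_weight_def intro!: tendsto_intros)
      show "AE \<omega> in M. norm (poisson_weight n (rate * D k \<omega>)) \<le> 1" for k
        using conv[of k]
        by eventually_elim
           (use \<open>0 < rate\<close> poisson_weight_bounds in \<open>auto simp: abs_le_iff intro: order_trans[of _ 0]\<close>)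
    qed auto
    moreover have "expectation (\<lambda>\<omega>. poisson_weight n (rate * D k \<omega>)) =
        prob {\<omega> \<in> space M. N (D k \<omega>) \<omega> = n}" for k
      unfolding D_def
    proof (rule poisson_at_independent_discrete_time[symmetric,
          where J = "J k" and g = "\<lambda>j. real (Suc j) / 2 ^ k"])
      fix t :: real and j assume "0 \<le> t"
      moreover have "{x. nat \<lfloor>2 ^ k * x\<rfloor> = j} \<in> sets (borel :: real measure)"
      proof -
        have "(\<lambda>x :: real. nat \<lfloor>2 ^ k * x\<rfloor>) \<in> borel \<rightarrow>\<^sub>M count_space UNIV" by measurable
        from measurable_sets[OF this, of "{j}"] show ?thesis by (simp add: vimage_def)
      qed
      ultimately show "prob ({\<omega> \<in> space M. N t \<omega> = n} \<inter> {\<omega> \<in> space M. J k \<omega> = j}) =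
          prob {\<omega> \<in> space M. N t \<omega> = n} * prob {\<omega> \<in> space M. J k \<omega> = j}"
        using indep[of t "{x. nat \<lfloor>2 ^ k * x\<rfloor> = j}" n] by (simp add: J_def)
    qed (use N law J \<open>0 < rate\<close> in auto)
    ultimately show "(\<lambda>k. prob {\<omega> \<in> space M. N (D k \<omega>) \<omega> = n}) \<longlonglongrightarrow>
        expectation (\<lambda>\<omega>. poisson_weight n (rate * T \<omega>))" by simp
  qed
  moreover have "measure (completion M) {\<omega> \<in> space M. N (T \<omega>) \<omega> = n} = measure (completion M) (S n)"
  proof (rule measure_eq_AE)
    show "AE \<omega> in completion M. \<omega> \<in> {\<omega> \<in> space M. N (T \<omega>) \<omega> = n} \<longleftrightarrow> \<omega> \<in> S n"
      using AE_completion[OF AE_conjI[OF S_eq[of n] AE_space]] by eventually_elim auto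
  qed (use meas_n S in auto)
  ultimately show "?law n"
    using S by simp
qed

section \<open>The state equations determine the law\<close>

lemma fps_mult_law_has_real_derivative:
  "((\<lambda>w. (P * law_fps \<alpha> w) $ n) has_real_derivative
    - ((P * (binomial_fps \<alpha> * law_fps \<alpha> w)) $ n)) (at w)"
proof -
  have "((\<lambda>w. \<Sum>i = 0..n. P $ i * law_fps \<alpha> w $ (n - i)) has_real_derivative
      (\<Sum>i = 0..n. P $ i * - ((binomial_fps \<alpha> * law_fps \<alpha> w) $ (n - i)))) (at w)"
    by (intro DERIV_sum DERIV_cmult law_fps_nth_has_real_derivative)
  then show ?thesis
    by (simp add: fps_mult_nth[of P] sum_negf)
qed

lemma continuous_on_fps_mult_law [continuous_intros]:
  "continuous_on S f \<Longrightarrow> continuous_on S (\<lambda>x. (P * law_fps \<alpha> (f x)) $ n)"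
  by (rule continuous_on_compose2[where t = UNIV and g = "\<lambda>w. (P * law_fps \<alpha> w) $ n"])
     (auto intro!: continuous_at_imp_continuous_on DERIV_isCont[OF fps_mult_law_has_real_derivative])

lemma continuous_on_law [continuous_intros]:
  "continuous_on S f \<Longrightarrow> continuous_on S (\<lambda>x. law_fps \<alpha> (f x) $ n)"
  using continuous_on_fps_mult_law[of S f 1] by simp

lemma backward_shift_funpow: "(backward_shift ^^ k) q n = q (n - int k)"
  by (induction k arbitrary: n) (auto simp: backward_shift_def algebra_simps)

lemma fractional_difference_eq_sum:
  assumes "\<And>m. m < 0 \<Longrightarrow> q m = 0"
  shows "fractional_difference \<alpha> q (int n) = (\<Sum>k = 0..n. binomial_fps \<alpha> $ k * q (int (n - k)))"
proof -
  have "fractional_difference \<alpha> q (int n) =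
      (\<Sum>k = 0..n. (\<alpha> gchoose k) * (- 1) ^ k * q (int n - int k))"
    unfolding fractional_difference_def backward_shift_funpow
    by (rule suminf_finite) (use assms in auto)
  also have "\<dots> = (\<Sum>k = 0..n. binomial_fps \<alpha> $ k * q (int (n - k)))"
    by (rule sum.cong) (auto simp: binomial_fps_def of_nat_diff)
  finally show ?thesis .
qed

text \<open>The assumptions \<open>bounded\<close> and \<open>axes\<close> are supplied by
  probability: the state equations prescribe axis values for state 0 only. The induction keeps
  \<open>l\<close>, \<open>t1\<close>, \<open>t2\<close> arbitrary because lower states must be
  known at all parameters and times.\<close>

lemma state_probability_unique:
  fixes p :: "real \<Rightarrow> int \<Rightarrow> real \<Rightarrow> real \<Rightarrow> real"
  assumes \<alpha>: "0 < \<alpha>" and eqs: "sf_state_equations \<alpha> p"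
    and bounded: "\<And>l n t1 t2. 0 < l \<Longrightarrow> 0 \<le> t1 \<Longrightarrow> 0 \<le> t2 \<Longrightarrow> \<bar>p l n t1 t2\<bar> \<le> 1"
    and axes: "\<And>l n t. 0 < l \<Longrightarrow> 0 < n \<Longrightarrow> 0 \<le> t \<Longrightarrow> p l n 0 t = 0 \<and> p l n t 0 = 0"
    and "0 < l" "0 \<le> t1" "0 \<le> t2"
  shows "p l (int n) t1 t2 = law_fps \<alpha> (l powr \<alpha> * (t1 * t2)) $ n"
  using assms(5-7)
proof (induction n arbitrary: l t1 t2 rule: less_induct)
  case (less n)
  note l = \<open>0 < l\<close>
  let ?A = "binomial_fps \<alpha>"
  define G where "G w = law_fps \<alpha> w" for w
  \<comment> \<open>The inverse of the change of parameter: \<open>L \<tau>\<close> is the value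
    \<open>l\<close> with \<open>l powr (- \<alpha>) = \<tau>\<close>.\<close>
  define L where "L \<tau> = \<tau> powr (- 1 / \<alpha>)" for \<tau>
  have L_pos: "0 < L \<tau>" if "0 < \<tau>" for \<tau>
    using that by (simp add: L_def)
  have L_powr: "L \<tau> powr \<alpha> = 1 / \<tau>" if "0 < \<tau>" for \<tau>
  proof -
    have "L \<tau> powr \<alpha> = \<tau> powr (- 1 / \<alpha> * \<alpha>)"
      unfolding L_def by (rule powr_powr)
    then show ?thesis using that \<alpha> by (simp add: powr_minus_divide)
  qed
  note S = eqs[unfolded sf_state_equations_def]
  note S1 = S[THEN conjunct1] and S2 = S[THEN conjunct2, THEN conjunct1]
    and S3 = S[THEN conjunct2, THEN conjunct2, THEN conjunct1]
    and S4 = S[THEN conjunct2, THEN conjunct2, THEN conjunct2, THEN conjunct1]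
    and S5 = S[THEN conjunct2, THEN conjunct2, THEN conjunct2, THEN conjunct2]
  have p_cont: "continuous_on ({0..} \<times> {0..}) (\<lambda>(r, s). p l (int n) r s)" if "0 < l" for l
    using S1 that by auto
  have p_diff: "mixed_differentiable (p l (int n)) r s" if "0 < l" "0 < r" "0 < s" for l r s
    using S2 that by auto
  have p_mixed_cont: "continuous_on ({0<..} \<times> {0<..} \<times> {0<..})
      (\<lambda>(l, r, s). mixed_deriv (p l (int n)) r s)"
    using S3 by auto
  define fd where "fd r s l = fractional_difference \<alpha> (\<lambda>m. p l m r s) (int n)" for r s l
  have fd_diff: "fd r s differentiable at l" and p_eq: "mixed_deriv (p l (int n)) r s =
      - (l powr (\<alpha> + 1) / \<alpha> * deriv (fd r s) l + l powr \<alpha> * fd r s l)"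
    if "0 < l" "0 < r" "0 < s" for l r s
    using S4[rule_format, of "int n" l r s] that by (auto simp: fd_def[abs_def])
  have p_0: "p l 0 0 t = 1" "p l 0 t 0 = 1" if "0 < l" "0 \<le> t" for l t
    using S5 that by auto
  have p_neg: "p l m r s = 0" if "m < 0" "0 < l" "0 \<le> r" "0 \<le> s" for l m r s
    using S5 that by auto
  have fd_eq: "fd r s l = p l (int n) r s - G (l powr \<alpha> * (r * s)) $ n
      + (?A * G (l powr \<alpha> * (r * s))) $ n"
    if "0 < l" "0 \<le> r" "0 \<le> s" for r s l
  proof -
    \<comment> \<open>Only the summand \<open>k = 0\<close>, with coefficient 1, contains the
      unknown state \<open>n\<close>; the induction hypothesis turns the others into coefficients of
      \<open>G\<close>.\<close>
    have "fd r s l = (\<Sum>k = 0..n. ?A $ k * p l (int (n - k)) r s)"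
      unfolding fd_def using that by (intro fractional_difference_eq_sum p_neg) auto
    also have "\<dots> = p l (int n) r s + (\<Sum>k = Suc 0..n. ?A $ k * p l (int (n - k)) r s)"
      by (simp add: sum.atLeast_Suc_atMost)
    also have "(\<Sum>k = Suc 0..n. ?A $ k * p l (int (n - k)) r s) =
        (\<Sum>k = Suc 0..n. ?A $ k * G (l powr \<alpha> * (r * s)) $ (n - k))"
      using that unfolding G_def by (intro sum.cong arg_cong2[where f = "(*)"] refl less.IH) auto
    also have "\<dots> = (?A * G (l powr \<alpha> * (r * s))) $ n - G (l powr \<alpha> * (r * s)) $ n"
      by (simp add: fps_mult_nth[of ?A] sum.atLeast_Suc_atMost)
    finally show ?thesis by simp
  qed
  \<comment> \<open>With \<open>\<tau> = l powr - \<alpha>\<close> and the factor \<open>1 / \<tau>\<close>, the operator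
    \<open>- (l\<^sup>\<alpha>\<^sup>+\<^sup>1 / \<alpha> \<partial>\<^sub>l + l\<^sup>\<alpha>)\<close> becomes \<open>\<partial>\<^sub>\<tau>\<close>.\<close>
  define q where "q \<tau> r s = (p (L \<tau>) (int n) r s - G (r * s / \<tau>) $ n) / \<tau>" for \<tau> r s
  \<comment> \<open>Each differentiation of \<open>G\<close> in its argument brings a factor
    \<open>- ?A\<close>; \<open>s / \<tau>\<close> and \<open>r / \<tau>\<close> come from the
    argument \<open>r * s / \<tau>\<close>.\<close>
  define q1 where "q1 \<tau> r s = (deriv (\<lambda>r. p (L \<tau>) (int n) r s) r
      + s / \<tau> * (?A * G (r * s / \<tau>)) $ n) / \<tau>" for \<tau> r s
  define q12 where "q12 \<tau> r s = (mixed_deriv (p (L \<tau>) (int n)) r s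
      + (1 / \<tau> * (?A * G (r * s / \<tau>)) $ n - r * s / \<tau>\<^sup>2 * (?A * (?A * G (r * s / \<tau>))) $ n)) / \<tau>"
    for \<tau> r s
  define K where "K = (\<Sum>i = 0..n. \<bar>(?A - 1) ^ i $ n\<bar>)"
  define \<tau>0 where "\<tau>0 = l powr (- \<alpha>)"
  have \<tau>0: "0 < \<tau>0" "L \<tau>0 = l" "1 / \<tau>0 = l powr \<alpha>"
  proof -
    have "L \<tau>0 = l powr (- \<alpha> * (- 1 / \<alpha>))"
      unfolding L_def \<tau>0_def by (rule powr_powr)
    then show "L \<tau>0 = l" using l \<alpha> by simp
  qed (use l in \<open>simp_all add: \<tau>0_def powr_minus_divide\<close>)
  \<comment> \<open>The half-line contains \<open>\<tau>0\<close> and stays away from 0, where the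
    factor \<open>1 / \<tau>\<close> in \<open>q\<close> would blow up. In the numerator, 1 bounds
    the probability and \<open>K\<close> the coefficient of \<open>G\<close>.\<close>
  interpret goursat q q1 q12 "\<tau>0 / 2" "(1 + K) / (\<tau>0 / 2)"
  proof
    fix \<tau> assume "\<tau>0 / 2 < \<tau>"
    then have \<tau>: "0 < \<tau>" using \<tau>0 by simp
    show "continuous_on ({0..} \<times> {0..}) (\<lambda>(r, s). q \<tau> r s)"
      using p_cont[OF L_pos[OF \<tau>]] \<tau> unfolding q_def G_def split_beta
      by (intro continuous_intros) auto
    \<comment> \<open>On the axes \<open>G 0\<close> is the series 1: for \<open>n = 0\<close> it
      cancels the boundary value 1, and for \<open>n > 0\<close> both terms are 0.\<close>
    show "q \<tau> 0 t = 0 \<and> q \<tau> t 0 = 0" if "0 \<le> t" for t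
      using p_0[OF L_pos[OF \<tau>] that] axes[OF L_pos[OF \<tau>] _ that, of "int n"]
      by (cases "n = 0") (auto simp: q_def G_def law_fps_0)
    show "\<bar>q \<tau> r s\<bar> \<le> (1 + K) / (\<tau>0 / 2)" if "0 \<le> r" "0 \<le> s" for r s
    proof -
      have "\<bar>p (L \<tau>) (int n) r s - G (r * s / \<tau>) $ n\<bar> \<le> 1 + K"
        using bounded[OF L_pos[OF \<tau>] that, of "int n"] abs_law_fps_nth_le[of "r * s / \<tau>" \<alpha> n] that \<tau>
        unfolding K_def G_def by simp
      then show ?thesis
        unfolding q_def abs_divide using \<tau> \<tau>0 \<open>\<tau>0 / 2 < \<tau>\<close> by (intro frac_le) auto
    qed
    fix r s :: real assume rs: "0 < r" "0 < s"
    have "((\<lambda>r. p (L \<tau>) (int n) r s) has_real_derivative deriv (\<lambda>r. p (L \<tau>) (int n) r s) r) (at r)"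
      using p_diff[OF L_pos[OF \<tau>] rs] unfolding mixed_differentiable_def
      by (metis DERIV_deriv_iff_real_differentiable)
    moreover have "((\<lambda>r. G (r * s / \<tau>) $ n) has_real_derivative
        - ((?A * G (r * s / \<tau>)) $ n) * (s / \<tau>)) (at r)"
      unfolding G_def
      by (rule DERIV_chain'[OF _ law_fps_nth_has_real_derivative])
         (use \<tau> in \<open>auto intro!: derivative_eq_intros\<close>)
    ultimately show "((\<lambda>r. q \<tau> r s) has_real_derivative q1 \<tau> r s) (at r)"
      unfolding q_def q1_def
      by (intro DERIV_cdivide) (auto dest: DERIV_diff simp: mult.commute)
    have "((\<lambda>s. deriv (\<lambda>r. p (L \<tau>) (int n) r s) r) has_real_derivative
        mixed_deriv (p (L \<tau>) (int n)) r s) (at s)"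
      using p_diff[OF L_pos[OF \<tau>] rs] unfolding mixed_differentiable_def mixed_deriv_def
      by (metis DERIV_deriv_iff_real_differentiable)
    moreover have "((\<lambda>s. s / \<tau> * (?A * G (r * s / \<tau>)) $ n) has_real_derivative
        1 / \<tau> * (?A * G (r * s / \<tau>)) $ n - r * s / \<tau>\<^sup>2 * (?A * (?A * G (r * s / \<tau>))) $ n) (at s)"
    proof -
      have "((\<lambda>s. (?A * G (r * s / \<tau>)) $ n) has_real_derivative
          - ((?A * (?A * G (r * s / \<tau>))) $ n) * (r / \<tau>)) (at s)"
        unfolding G_def
        by (rule DERIV_chain'[OF _ fps_mult_law_has_real_derivative])
           (use \<tau> in \<open>auto intro!: derivative_eq_intros\<close>)
      moreover have "((\<lambda>s. s / \<tau>) has_real_derivative 1 / \<tau>) (at s)"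
        by (intro DERIV_cdivide DERIV_ident)
      ultimately have "((\<lambda>s. s / \<tau> * (?A * G (r * s / \<tau>)) $ n) has_real_derivative
          1 / \<tau> * (?A * G (r * s / \<tau>)) $ n + - ((?A * (?A * G (r * s / \<tau>))) $ n) * (r / \<tau>) * (s / \<tau>)) (at s)"
        by (rule DERIV_mult[rotated])
      then show ?thesis
        by (simp add: power2_eq_square mult_ac)
    qed
    ultimately show "(q1 \<tau> r has_real_derivative q12 \<tau> r s) (at s)"
      unfolding q1_def q12_def by (intro DERIV_cdivide DERIV_add)
    show "((\<lambda>\<tau>. q \<tau> r s) has_real_derivative q12 \<tau> r s) (at \<tau>)"
    proof -
      have L': "(L has_real_derivative - L \<tau> / \<tau> / \<alpha>) (at \<tau>)"
      proof -
        have "(L has_real_derivative (- 1 / \<alpha>) * \<tau> powr (- 1 / \<alpha> - 1)) (at \<tau>)"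
          unfolding L_def using \<tau> by (intro has_real_derivative_powr) auto
        then show ?thesis
          using \<tau> by (simp add: L_def powr_diff mult.commute)
      qed
      have fd': "((\<lambda>\<tau>. fd r s (L \<tau>)) has_real_derivative deriv (fd r s) (L \<tau>) * (- L \<tau> / \<tau> / \<alpha>)) (at \<tau>)"
        by (rule DERIV_chain2[where f = "fd r s", OF _ L'])
           (use fd_diff[OF L_pos[OF \<tau>] rs] in \<open>simp add: DERIV_deriv_iff_real_differentiable\<close>)
      have G': "((\<lambda>\<tau>. (?A * G (r * s / \<tau>)) $ n) has_real_derivative
          - ((?A * (?A * G (r * s / \<tau>))) $ n) * (- (r * s) / \<tau>\<^sup>2)) (at \<tau>)"
        unfolding G_def
        by (rule DERIV_chain'[where f = "\<lambda>\<tau>. r * s / \<tau>", OF _ fps_mult_law_has_real_derivative])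
           (use \<tau> in \<open>auto intro!: derivative_eq_intros simp: power2_eq_square\<close>)
      \<comment> \<open>The numerator of \<open>q\<close> is rewritten through \<open>fd\<close>,
        for which differentiability in the parameter is given; \<open>fd_eq\<close> provides the
        passage back to \<open>p\<close>.\<close>
      have "((\<lambda>\<tau>. (fd r s (L \<tau>) - (?A * G (r * s / \<tau>)) $ n) / \<tau>) has_real_derivative
          ((deriv (fd r s) (L \<tau>) * (- L \<tau> / \<tau> / \<alpha>)
            - - ((?A * (?A * G (r * s / \<tau>))) $ n) * (- (r * s) / \<tau>\<^sup>2)) * \<tau>
          - (fd r s (L \<tau>) - (?A * G (r * s / \<tau>)) $ n) * 1) / (\<tau> * \<tau>)) (at \<tau>)"
        by (rule DERIV_divide[OF DERIV_diff[OF fd' G'] DERIV_ident]) (use \<tau> in simp)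
      also have "((deriv (fd r s) (L \<tau>) * (- L \<tau> / \<tau> / \<alpha>)
            - - ((?A * (?A * G (r * s / \<tau>))) $ n) * (- (r * s) / \<tau>\<^sup>2)) * \<tau>
          - (fd r s (L \<tau>) - (?A * G (r * s / \<tau>)) $ n) * 1) / (\<tau> * \<tau>) = q12 \<tau> r s"
        unfolding q12_def p_eq[OF L_pos[OF \<tau>] rs] powr_add L_powr[OF \<tau>]
        using \<tau> \<alpha> L_pos[OF \<tau>] by (simp add: field_simps power2_eq_square)
      finally have "((\<lambda>\<tau>. (fd r s (L \<tau>) - (?A * G (r * s / \<tau>)) $ n) / \<tau>) has_real_derivative
          q12 \<tau> r s) (at \<tau>)" .
      then show ?thesis
      proof (rule has_field_derivative_transform_within[where d = \<tau>])
        fix y assume "dist y \<tau> < \<tau>"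
        then have "0 < y" by (auto simp: dist_real_def)
        then show "(fd r s (L y) - (?A * G (r * s / y)) $ n) / y = q y r s"
          using fd_eq[OF L_pos[of y], of r s] L_powr[of y] rs by (simp add: q_def)
      qed (use \<tau> in auto)
    qed
  next
    have "continuous_on ({\<tau>0 / 2<..} \<times> {0<..} \<times> {0<..})
        (\<lambda>x. (\<lambda>(l, r, s). mixed_deriv (p l (int n)) r s) (L (fst x), fst (snd x), snd (snd x)))"
      by (rule continuous_on_compose2[OF p_mixed_cont])
         (use \<tau>0 in \<open>auto simp: L_def intro!: continuous_intros\<close>)
    \<comment> \<open>Reassociating to \<open>(?A * ?A) * G\<close> puts the last term into the form
      of \<open>continuous_on_fps_mult_law\<close>.\<close>
    then show "continuous_on ({\<tau>0 / 2<..} \<times> {0<..} \<times> {0<..}) (\<lambda>(\<tau>, r, s). q12 \<tau> r s)"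
      using \<tau>0 unfolding q12_def G_def split_beta mult.assoc[symmetric, where 'a = "real fps"]
      by (intro continuous_intros) auto
  qed
  have "q \<tau>0 t1 t2 = 0"
    by (rule vanishes) (use \<tau>0 less.prems in auto)
  then have "p l (int n) t1 t2 = G (t1 * t2 / \<tau>0) $ n"
    using \<tau>0(1) by (simp add: q_def \<tau>0(2))
  also have "t1 * t2 / \<tau>0 = l powr \<alpha> * (t1 * t2)"
    unfolding \<tau>0(3)[symmetric] by simp
  finally show ?case by (simp add: G_def)
qed

section \<open>From the processes to their one-point laws\<close>

lemma process_eventI:
  assumes "i \<in> I" "A \<in> sets S" "space S = UNIV"
  shows "{\<omega> \<in> space M. X i \<omega> \<in> A} \<in> process_events M I S X"
proof -
  have "(\<lambda>x. x i) -` A \<inter> space (Pi\<^sub>M I (\<lambda>_. S)) \<in> sets (Pi\<^sub>M I (\<lambda>_. S))"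
    by (rule measurable_sets[OF measurable_component_singleton]) (use assms in auto)
  from in_vimage_algebra[OF this, of "\<lambda>\<omega>. \<lambda>i\<in>I. X i \<omega>" "space M"]
  show ?thesis
    using assms unfolding process_events_def
    by (elim back_subst[of "\<lambda>A. A \<in> _"]) (auto simp: space_PiM)
qed

lemma poisson_process_one_dim_law:
  assumes N: "poisson_process M rate N" and "0 < t"
  shows "measure M {\<omega> \<in> space M. N t \<omega> = n} = poisson_weight n (rate * t)"
proof -
  interpret prob_space M using N by (simp add: poisson_process_def)
  have meas: "N s \<in> M \<rightarrow>\<^sub>M count_space UNIV" if "0 \<le> s" for s
    using N that by (simp add: poisson_process_def)
  have [measurable]: "N t \<in> M \<rightarrow>\<^sub>M count_space UNIV" "N 0 \<in> M \<rightarrow>\<^sub>M count_space UNIV"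
    using meas \<open>0 < t\<close> by auto
  have N0: "AE \<omega> in M. N 0 \<omega> = 0" and rate: "0 < rate"
    using N by (simp_all add: poisson_process_def)
  \<comment> \<open>\<open>N t\<close> is an increment from time 0 only almost surely, since
    \<open>N 0 = 0\<close> holds outside a null set.\<close>
  have "prob {\<omega> \<in> space M. N t \<omega> = n} = prob {\<omega> \<in> space M. N t \<omega> - N 0 \<omega> = n}"
    by (rule measure_eq_AE) (use N0 in \<open>auto elim!: eventually_mono\<close>)
  also have "\<dots> = measure (distr M (count_space UNIV) (\<lambda>\<omega>. N t \<omega> - N 0 \<omega>)) {n}"
    by (subst measure_distr) (auto simp: vimage_def Int_def conj_commute)
  also have "distr M (count_space UNIV) (\<lambda>\<omega>. N t \<omega> - N 0 \<omega>) = measure_pmf (poisson_pmf (rate * t))"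
    using N \<open>0 < t\<close> unfolding poisson_process_def by (metis diff_zero order_refl)
  also have "measure (measure_pmf (poisson_pmf (rate * t))) {n} = poisson_weight n (rate * t)"
    using rate \<open>0 < t\<close> by (simp add: measure_pmf_single poisson_weight_def)
  finally show ?thesis .
qed

text \<open>The generating function at \<open>z\<close> is the Laplace transform of
  \<open>H t1 t2\<close> at \<open>lam * (1 - z)\<close>, which is positive because
  \<open>z < 1\<close>; the power \<open>\<alpha>\<close> then splits multiplicatively.\<close>

lemma subordinated_law:
  assumes "0 < lam" and N: "poisson_process M lam N" and H: "stable_subordinator2 M \<alpha> H"
    and indep: "independent_processes M {0..} (count_space UNIV) N
           ({0..} \<times> {0..}) borel (\<lambda>(t1, t2). H t1 t2)"
    and t: "0 \<le> t1" "0 \<le> t2"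
  shows "subordinated N H t1 t2 \<in> completion M \<rightarrow>\<^sub>M count_space UNIV"
    and "measure (completion M) {\<omega> \<in> space M. subordinated N H t1 t2 \<omega> = n} =
      law_fps \<alpha> (lam powr \<alpha> * (t1 * t2)) $ n"
proof -
  interpret prob_space M using N by (simp add: poisson_process_def)
  have H_meas: "H t1 t2 \<in> borel_measurable M"
    using H t by (simp add: stable_subordinator2_def)
  \<comment> \<open>Nonnegativity comes from comparing \<open>H t1 t2\<close> with its value on the
    axis.\<close>
  have "AE \<omega> in M. H 0 t2 \<omega> = 0 \<and> H t2 0 \<omega> = 0" "AE \<omega> in M. H 0 t2 \<omega> \<le> H t1 t2 \<omega>"
    using H t by (simp_all add: stable_subordinator2_def)
  then have H_nonneg: "AE \<omega> in M. 0 \<le> H t1 t2 \<omega>"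
    by eventually_elim auto
  have N_meas: "N t \<in> M \<rightarrow>\<^sub>M count_space UNIV" if "0 \<le> t" for t
    using N that by (simp add: poisson_process_def)
  have right_cont: "AE \<omega> in M. \<forall>t\<ge>0. continuous (at_right t) (\<lambda>s. N s \<omega>)"
    using N by (auto simp: poisson_process_def)
  have prod: "prob ({\<omega> \<in> space M. N t \<omega> = n} \<inter> {\<omega> \<in> space M. H t1 t2 \<omega> \<in> A}) =
      prob {\<omega> \<in> space M. N t \<omega> = n} * prob {\<omega> \<in> space M. H t1 t2 \<omega> \<in> A}"
    if "0 \<le> t" "A \<in> sets borel" for t n A
  proof (rule indep_setD[OF indep[unfolded independent_processes_def]])
    show "{\<omega> \<in> space M. N t \<omega> = n} \<in> process_events M {0..} (count_space UNIV) N"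
      using process_eventI[of t "{0..}" "{n}" "count_space UNIV" M N] that by simp
    show "{\<omega> \<in> space M. H t1 t2 \<omega> \<in> A} \<in>
        process_events M ({0..} \<times> {0..}) borel (\<lambda>(t1, t2). H t1 t2)"
      using process_eventI[of "(t1, t2)" "{0..} \<times> {0..}" A borel M "\<lambda>(t1, t2). H t1 t2"] that t
      by simp
  qed
  note at_T = poisson_at_independent_time[where N = N and T = "H t1 t2" and rate = lam,
      OF N_meas poisson_process_one_dim_law[OF N] right_cont H_meas H_nonneg prod \<open>0 < lam\<close>]
  have eq: "subordinated N H t1 t2 = (\<lambda>\<omega>. N (H t1 t2 \<omega>) \<omega>)"
    by (rule ext) (rule subordinated_def)
  show "subordinated N H t1 t2 \<in> completion M \<rightarrow>\<^sub>M count_space UNIV"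
    unfolding eq by (rule at_T(1))
  define a where "a n = expectation (\<lambda>\<omega>. poisson_weight n (lam * H t1 t2 \<omega>))" for n
  have "a n = law_fps \<alpha> (lam powr \<alpha> * (t1 * t2)) $ n"
  proof (rule law_fps_nth_eqI)
    fix z :: real assume z: "\<bar>z\<bar> < 1"
    have "(\<lambda>n. a n * z ^ n) sums expectation (\<lambda>\<omega>. exp (- (lam * (1 - z)) * H t1 t2 \<omega>))"
      unfolding a_def by (rule poisson_mixture_generating_function) fact+
    also have "expectation (\<lambda>\<omega>. exp (- (lam * (1 - z)) * H t1 t2 \<omega>)) =
        exp (- (t1 * t2 * (lam * (1 - z)) powr \<alpha>))"
      using H t z \<open>0 < lam\<close> unfolding stable_subordinator2_def by simp
    also have "(lam * (1 - z)) powr \<alpha> = lam powr \<alpha> * (1 - z) powr \<alpha>"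
      by (rule powr_mult)
    finally show "(\<lambda>n. a n * z ^ n) sums exp (- (lam powr \<alpha> * (t1 * t2) * (1 - z) powr \<alpha>))"
      by (simp add: mult_ac)
  qed
  moreover have "measure (completion M) {\<omega> \<in> space M. subordinated N H t1 t2 \<omega> = n} = a n"
    unfolding eq a_def by (rule at_T(2))
  ultimately show "measure (completion M) {\<omega> \<in> space M. subordinated N H t1 t2 \<omega> = n} =
      law_fps \<alpha> (lam powr \<alpha> * (t1 * t2)) $ n" by simp
qed

lemma space_fractional_poisson_field_law:
  assumes X: "space_fractional_poisson_field \<alpha> M X" and "0 < l" "0 \<le> t1" "0 \<le> t2"
  shows "measure (M l) {\<omega> \<in> space (M l). X l t1 t2 \<omega> = n} = law_fps \<alpha> (l powr \<alpha> * (t1 * t2)) $ n"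
proof -
  define p where "p l n t1 t2 = measure (M l) {\<omega> \<in> space (M l). int (X l t1 t2 \<omega>) = n}" for l n t1 t2
  have \<alpha>: "0 < \<alpha>" and eqs: "sf_state_equations \<alpha> p"
    and prob: "\<And>l. 0 < l \<Longrightarrow> prob_space (M l)"
    and meas: "\<And>l t1 t2. 0 < l \<Longrightarrow> 0 \<le> t1 \<Longrightarrow> 0 \<le> t2 \<Longrightarrow> X l t1 t2 \<in> M l \<rightarrow>\<^sub>M count_space UNIV"
    using X unfolding space_fractional_poisson_field_def p_def by auto
  \<comment> \<open>If state 0 has probability 1, the disjoint event of a positive state has no mass
    left. This supplies the axis values for positive states.\<close>
  have zero: "p l n t1 t2 = 0" if "p l 0 t1 t2 = 1" "0 < n" "0 < l" "0 \<le> t1" "0 \<le> t2" for l n t1 t2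
  proof -
    interpret prob_space "M l" by (rule prob) fact
    note [measurable] = meas[OF that(3-5)]
    have "p l n t1 t2 + p l 0 t1 t2 = prob ({\<omega> \<in> space (M l). int (X l t1 t2 \<omega>) = n} \<union>
        {\<omega> \<in> space (M l). int (X l t1 t2 \<omega>) = 0})"
      unfolding p_def using \<open>0 < n\<close> by (subst finite_measure_Union) auto
    also have "\<dots> \<le> 1" by (rule prob_le_1)
    finally have "p l n t1 t2 \<le> 0" using that(1) by simp
    moreover have "0 \<le> p l n t1 t2" by (simp add: p_def)
    ultimately show ?thesis by simp
  qed
  have "p l (int n) t1 t2 = law_fps \<alpha> (l powr \<alpha> * (t1 * t2)) $ n"
  proof (rule state_probability_unique[OF \<alpha> eqs])
    show "\<bar>p l n t1 t2\<bar> \<le> 1" if "0 < l" "0 \<le> t1" "0 \<le> t2" for l n t1 t2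
      using prob_space.prob_le_1[OF prob[OF that(1)]] by (simp add: p_def)
    show "p l n 0 t = 0 \<and> p l n t 0 = 0" if "0 < l" "0 < n" "0 \<le> t" for l n t
      using eqs that by (auto intro!: zero simp: sf_state_equations_def)
  qed fact+
  then show ?thesis by (simp add: p_def)
qed

theorem theorem5p1:
  fixes \<alpha> lam t1 t2 :: real
    and M\<^sub>\<alpha> :: "real \<Rightarrow> 'a measure" and N\<^sub>\<alpha> :: "real \<Rightarrow> real \<Rightarrow> real \<Rightarrow> 'a \<Rightarrow> nat"
    and M :: "'b measure" and N :: "real \<Rightarrow> 'b \<Rightarrow> nat" and H :: "real \<Rightarrow> real \<Rightarrow> 'b \<Rightarrow> real"
  assumes "0 < \<alpha>" "\<alpha> < 1" "0 < lam"
    and "space_fractional_poisson_field \<alpha> M\<^sub>\<alpha> N\<^sub>\<alpha>"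
    and "poisson_process M lam N"
    and "stable_subordinator2 M \<alpha> H"
    and "independent_processes M {0..} (count_space UNIV) N
           ({0..} \<times> {0..}) borel (\<lambda>(t1, t2). H t1 t2)"
    and "0 \<le> t1" "0 \<le> t2"
  shows "equal_in_distribution (count_space UNIV)
           (M\<^sub>\<alpha> lam) (N\<^sub>\<alpha> lam t1 t2) (completion M) (subordinated N H t1 t2)"
  unfolding equal_in_distribution_def
proof (intro conjI)
  note sub = subordinated_law[OF assms(3,5-9)]
  show meas1: "N\<^sub>\<alpha> lam t1 t2 \<in> M\<^sub>\<alpha> lam \<rightarrow>\<^sub>M count_space UNIV"
    using assms unfolding space_fractional_poisson_field_def by auto
  show meas2: "subordinated N H t1 t2 \<in> completion M \<rightarrow>\<^sub>M count_space UNIV"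
    by (rule sub(1))
  interpret field: prob_space "M\<^sub>\<alpha> lam"
    using assms unfolding space_fractional_poisson_field_def by auto
  interpret M: prob_space M
    using assms(5) by (simp add: poisson_process_def)
  interpret completed: prob_space "completion M"
    by (rule M.prob_space_completion)
  show "distr (M\<^sub>\<alpha> lam) (count_space UNIV) (N\<^sub>\<alpha> lam t1 t2) =
      distr (completion M) (count_space UNIV) (subordinated N H t1 t2)"
  proof (rule measure_eqI_countable[where A = UNIV])
    fix n
    have "field.prob {\<omega> \<in> space (M\<^sub>\<alpha> lam). N\<^sub>\<alpha> lam t1 t2 \<omega> = n} =
        completed.prob {\<omega> \<in> space M. subordinated N H t1 t2 \<omega> = n}"
      using space_fractional_poisson_field_law[OF assms(4,3,8,9)] sub(2) by simp
    then show "emeasure (distr (M\<^sub>\<alpha> lam) (count_space UNIV) (N\<^sub>\<alpha> lam t1 t2)) {n} =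
        emeasure (distr (completion M) (count_space UNIV) (subordinated N H t1 t2)) {n}"
      using meas1 meas2
      by (simp add: emeasure_distr field.emeasure_eq_measure completed.emeasure_eq_measure
          vimage_def Int_def conj_commute)
  qed auto
qed

end
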